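(* Suppose that $X, Y$ are metric spaces, $\dim_{\rm N} X \le n < \infty$, and $Y$ is complete. If $Y$ is Lipschitz $m$-connected for $m = 0,1,\dots,n-1$, then the pair $(X,Y)$ has the Lipschitz extension property.
   Context: A family $(B_i)_{i\in I}$ of subsets of a metric space $X=(X,d)$ is called $D$-bounded ($D \ge 0$) if $\operatorname{diam} B_i := \sup\{d(x,x') : x,x'\in B_i\} \le D$ for all $i$. For $s>0$, the $s$-multiplicity of the family is the infimum of all integers $n \ge 0$ such that every subset of $X$ with diameter $\le s$ meets at most $n$ members of the family. The Nagata dimension $\dim_{\rm N} X$ of a metric space $X$ is the infimum of all integers $n$ with the following property: there exists a constant $c>0$ such that for all $s>0$, $X$ has a $cs$-bounded covering with $s$-multiplicity at most $n+1$ (the value is $\infty$ if there is no such $n$). $\operatorname{Lip}(f)$ denotes the (smallest) Lipschitz constant of a Lipschitz map $f$. A pair of metric spaces $(X,Y)$ has the Lipschitz extension property if there is a constant $C$ such that for every subset $Z \subset X$ and for every Lipschitz map $f \colon Z \to Y$, there is a Lipschitz extension $\bar f \colon X \to Y$ of $f$ with $\operatorname{Lip}(\bar f) \le C \operatorname{Lip}(f)$. A metric space $Y$ is called Lipschitz $m$-connected, for an integer $m \ge 0$, if there is a constant $c_m$ such that every Lipschitz map $f \colon S^m \to Y$ has a Lipschitz extension $\bar f \colon B^{m+1} \to Y$ with $\operatorname{Lip}(\bar f) \le c_m \operatorname{Lip}(f)$; here $S^m$ and $B^{m+1}$ denote the unit sphere and closed unit ball in $\mathbb{R}^{m+1}$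 equipped with the metric induced from $\mathbb{R}^{m+1}$. *)

theory Defs
  imports "HOL-Analysis.Analysis"
begin

section \<open>Nagata dimension\<close>

text \<open>The diameter takes the value \<open>\<infinity>\<close> on unbounded sets. The empty set gets
  \<open>-\<infinity>\<close> rather than \<open>0\<close>, which is immaterial for comparisons with nonnegative bounds.\<close>

definition mdiam :: "'a metric \<Rightarrow> 'a set \<Rightarrow> ereal" where
  "mdiam X A = (SUP (x, y) \<in> A \<times> A. ereal (mdist X x y))"

definition D_bounded :: "'a metric \<Rightarrow> real \<Rightarrow> 'i set \<Rightarrow> ('i \<Rightarrow> 'a set) \<Rightarrow> bool" where
  "D_bounded X D I B \<longleftrightarrow> (\<forall>i\<in>I. mdiam X (B i) \<le> ereal D)"

text \<open>Members of a family are counted by their indices.\<close>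

definition meets_at_most :: "nat \<Rightarrow> 'i set \<Rightarrow> ('i \<Rightarrow> 'a set) \<Rightarrow> 'a set \<Rightarrow> bool" where
  "meets_at_most n I B A \<longleftrightarrow>
     finite {i \<in> I. A \<inter> B i \<noteq> {}} \<and> card {i \<in> I. A \<inter> B i \<noteq> {}} \<le> n"

definition multiplicity_at_scale ::
    "'a metric \<Rightarrow> real \<Rightarrow> 'i set \<Rightarrow> ('i \<Rightarrow> 'a set) \<Rightarrow> ereal" where
  "multiplicity_at_scale X s I B =
     Inf {ereal (real n) | n :: nat.
            \<forall>A. A \<subseteq> mspace X \<and> mdiam X A \<le> ereal s \<longrightarrow> meets_at_most n I B A}"

definition covering :: "'a metric \<Rightarrow> 'i set \<Rightarrow> ('i \<Rightarrow> 'a set) \<Rightarrow> bool" where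
  "covering X I B \<longleftrightarrow> (\<forall>i\<in>I. B i \<subseteq> mspace X) \<and> (\<Union>i\<in>I. B i) = mspace X"

text \<open>A definition cannot quantify over the index type of the covering, so the indices are
  taken from \<open>'a set\<close>; by \<open>covering_reindex\<close> below, no generality is lost.\<close>

definition nagata_dim_prop :: "'a metric \<Rightarrow> int \<Rightarrow> bool" where
  "nagata_dim_prop X n \<longleftrightarrow>
     (\<exists>c>0. \<forall>s>0. \<exists>(I :: 'a set set) (B :: 'a set \<Rightarrow> 'a set).
        covering X I B \<and> D_bounded X (c * s) I B \<and>
        multiplicity_at_scale X s I B \<le> ereal (real_of_int (n + 1)))"

definition nagata_dim :: "'a metric \<Rightarrow> ereal" where
  "nagata_dim X = Inf {ereal (real_of_int n) | n. nagata_dim_prop X n}"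

lemma covering_reindex:
  fixes I :: "'i set" and B :: "'i \<Rightarrow> 'a set"
  assumes "covering X I B" "D_bounded X D I B" "multiplicity_at_scale X s I B \<le> k"
  shows "covering X (B ` I) (\<lambda>U. U)" "D_bounded X D (B ` I) (\<lambda>U. U)"
    "multiplicity_at_scale X s (B ` I) (\<lambda>U. U) \<le> k"
proof -
  show "covering X (B ` I) (\<lambda>U. U)" "D_bounded X D (B ` I) (\<lambda>U. U)"
    using assms by (auto simp: covering_def D_bounded_def)
  have "meets_at_most n (B ` I) (\<lambda>U. U) A" if "meets_at_most n I B A" for n A
  proof -
    have eq: "{U \<in> B ` I. A \<inter> U \<noteq> {}} = B ` {i \<in> I. A \<inter> B i \<noteq> {}}"
      by auto
    show ?thesis
      using that unfolding meets_at_most_def eq by (meson card_image_le finite_imageI order_trans)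
  qed
  then have "multiplicity_at_scale X s (B ` I) (\<lambda>U. U) \<le> multiplicity_at_scale X s I B"
    unfolding multiplicity_at_scale_def by (intro Inf_superset_mono) blast
  then show "multiplicity_at_scale X s (B ` I) (\<lambda>U. U) \<le> k"
    using assms(3) by (rule order_trans)
qed


section \<open>Lipschitz constants and Lipschitz extensions\<close>

text \<open>Nonnegativity of \<open>L\<close> only matters on spaces with at most one point, where the
  constant is then \<open>0\<close>. Only meaningful for Lipschitz maps.\<close>

definition Lip :: "'a metric \<Rightarrow> 'b metric \<Rightarrow> ('a \<Rightarrow> 'b) \<Rightarrow> real" where
  "Lip X Y f = Inf {L. 0 \<le> L \<and>
     (\<forall>x\<in>mspace X. \<forall>y\<in>mspace X. mdist Y (f x) (f y) \<le> L * mdist X x y)}"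

definition Lipschitz_extension_property :: "'a metric \<Rightarrow> 'b metric \<Rightarrow> bool" where
  "Lipschitz_extension_property X Y \<longleftrightarrow>
     (\<exists>C. \<forall>Z f. Z \<subseteq> mspace X \<and> Lipschitz_continuous_map (submetric X Z) Y f \<longrightarrow>
        (\<exists>g. Lipschitz_continuous_map X Y g \<and> (\<forall>z\<in>Z. g z = f z) \<and>
             Lip X Y g \<le> C * Lip (submetric X Z) Y f))"


section \<open>Lipschitz connectedness\<close>

text \<open>Euclidean \<open>k\<close>-space has the same points as \<^term>\<open>Euclidean_space k\<close>, namely sequences
  vanishing from index \<open>k\<close> on.\<close>

definition Rn_metric :: "nat \<Rightarrow> (nat \<Rightarrow> real) metric" where
  "Rn_metric k = metric ({x. \<forall>i\<ge>k. x i = 0}, \<lambda>x y. L2_set (\<lambda>i. x i - y i) {..<k})"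

lemma Metric_space_Rn:
  "Metric_space {x :: nat \<Rightarrow> real. \<forall>i\<ge>k. x i = 0} (\<lambda>x y. L2_set (\<lambda>i. x i - y i) {..<k})"
proof
  fix x y z :: "nat \<Rightarrow> real"
  show "0 \<le> L2_set (\<lambda>i. x i - y i) {..<k}"
    by simp
  show "L2_set (\<lambda>i. x i - y i) {..<k} = L2_set (\<lambda>i. y i - x i) {..<k}"
    by (simp add: L2_set_def power2_commute)
  show "L2_set (\<lambda>i. x i - z i) {..<k}
      \<le> L2_set (\<lambda>i. x i - y i) {..<k} + L2_set (\<lambda>i. y i - z i) {..<k}"
    using L2_set_triangle_ineq[of "\<lambda>i. x i - y i" "\<lambda>i. y i - z i" "{..<k}"] by simp
  assume "x \<in> {x. \<forall>i\<ge>k. x i = 0}" "y \<in> {x. \<forall>i\<ge>k. x i = 0}"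
  then show "L2_set (\<lambda>i. x i - y i) {..<k} = 0 \<longleftrightarrow> x = y"
    by (simp add: L2_set_eq_0_iff fun_eq_iff) (metis lessThan_iff not_le)
qed

lemma mspace_Rn_metric [simp]: "mspace (Rn_metric k) = {x. \<forall>i\<ge>k. x i = 0}"
  unfolding Rn_metric_def by (rule Metric_space.mspace_metric[OF Metric_space_Rn])

lemma mdist_Rn_metric [simp]: "mdist (Rn_metric k) = (\<lambda>x y. L2_set (\<lambda>i. x i - y i) {..<k})"
  unfolding Rn_metric_def by (rule Metric_space.mdist_metric[OF Metric_space_Rn])

definition unit_sphere :: "nat \<Rightarrow> (nat \<Rightarrow> real) metric" where
  "unit_sphere m = submetric (Rn_metric (m + 1)) {x. L2_set x {..<m + 1} = 1}"

definition unit_ball :: "nat \<Rightarrow> (nat \<Rightarrow> real) metric" where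
  "unit_ball k = submetric (Rn_metric k) {x. L2_set x {..<k} \<le> 1}"

definition Lipschitz_connected :: "nat \<Rightarrow> 'b metric \<Rightarrow> bool" where
  "Lipschitz_connected m Y \<longleftrightarrow>
     (\<exists>c. \<forall>f. Lipschitz_continuous_map (unit_sphere m) Y f \<longrightarrow>
        (\<exists>g. Lipschitz_continuous_map (unit_ball (m + 1)) Y g \<and>
             (\<forall>x\<in>mspace (unit_sphere m). g x = f x) \<and>
             Lip (unit_ball (m + 1)) Y g \<le> c * Lip (unit_sphere m) Y f))"

end

theory Submission
  imports Defs
begin

text \<open>Write \<open>\<rho>\<close> for the distance to \<open>Z\<close>. The idea is to cut the region \<open>\<rho> > 0\<close> into pieces whose
size is comparable to their distance from \<open>Z\<close>, to replace each piece by the value of \<open>f\<close> at a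
nearby point of \<open>Z\<close>, and to interpolate between these values inside \<open>Y\<close>.

\<^item> A covering of multiplicity \<open>n + 1\<close> can be turned into a partition whose pieces have \<open>n + 1\<close>
  colours, different pieces of one colour being well separated
  (\<open>separated_colouring_of_covering\<close>). Gluing such partitions along the dyadic annuli
  \<open>2\<^sup>j \<le> \<rho> < 2\<^sup>j\<^sup>+\<^sup>1\<close> gives a coloured partition of \<open>\<rho> > 0\<close> in which both the size of the pieces
  and the separation inside a colour are proportional to \<open>\<rho>\<close> (\<open>whitney_colouring_exists\<close>).

\<^item> Near a point only one piece of each colour is visible, so a partition of unity may be indexed
  by the \<open>n + 1\<close> colours (\<open>whitney_weights\<close>). It gives weights \<open>g x\<close> in an \<open>n\<close>-dimensional
  simplex, with Lipschitz constant of order \<open>1 / \<rho>\<close>, and for each colour of positive weight an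
  anchor in \<open>Z\<close> at distance of order \<open>\<rho>\<close>.

\<^item> Connectedness of \<open>Y\<close> in dimensions below \<open>n\<close> allows one to span a simplex of dimension at most
  \<open>n\<close> on any vertices in \<open>Y\<close>, compatibly with faces and with Lipschitz constant proportional to
  the diameter of the vertex set (\<open>simplicial_filling_exists\<close>). One simplex is filled from its
  boundary by a radial projection onto the ball (\<open>simplex_fillable_atMost\<close>), and the skeleta are
  treated in order of dimension.

The extension sends \<open>x\<close> to the point with weights \<open>g x\<close> in the simplex spanned by the images of
the anchors of \<open>x\<close>. These images have diameter of order \<open>L \<rho>\<close>, where \<open>L\<close> is the Lipschitz constant
of \<open>f\<close>, and the weights vary at rate \<open>1 / \<rho>\<close>; the two factors \<open>\<rho>\<close> cancel
(\<open>Lipschitz_extension_of_colourings\<close>). Points with \<open>\<rho> = 0\<close> are treated as limits, which exist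
since \<open>Y\<close> is complete.\<close>

section \<open>Distance to a set\<close>

definition dist_set :: "'a metric \<Rightarrow> 'a set \<Rightarrow> 'a \<Rightarrow> real" where
  "dist_set X S x = (INF z\<in>S. mdist X x z)"

lemma dist_set_le: "z \<in> S \<Longrightarrow> dist_set X S x \<le> mdist X x z"
  unfolding dist_set_def by (rule cINF_lower) (auto intro: bdd_belowI2[of _ 0])

lemma dist_set_nonneg: "S \<noteq> {} \<Longrightarrow> 0 \<le> dist_set X S x"
  unfolding dist_set_def by (rule cINF_greatest) auto

lemma dist_set_less_imp:
  assumes "S \<noteq> {}" "dist_set X S x < r"
  obtains z where "z \<in> S" "mdist X x z < r"
  using assms unfolding dist_set_def by (metis cINF_less_iff bdd_belowI2 mdist_nonneg)

lemma dist_set_triangle: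
  assumes "S \<noteq> {}" "S \<subseteq> mspace X" "x \<in> mspace X" "y \<in> mspace X"
  shows "dist_set X S x \<le> mdist X x y + dist_set X S y"
proof -
  have "dist_set X S x - mdist X x y \<le> mdist X y z" if "z \<in> S" for z
    using dist_set_le[OF that, of X x] mdist_triangle[of x X y z] assms that by fastforce
  then have "dist_set X S x - mdist X x y \<le> dist_set X S y"
    unfolding dist_set_def[of X S y] using assms(1) by (intro cINF_greatest) auto
  then show ?thesis by simp
qed

lemma dist_set_abs_diff_le:
  assumes "S \<noteq> {}" "S \<subseteq> mspace X" "x \<in> mspace X" "y \<in> mspace X"
  shows "\<bar>dist_set X S x - dist_set X S y\<bar> \<le> mdist X x y"
  using dist_set_triangle[OF assms] dist_set_triangle[OF assms(1,2,4,3)]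
  by (simp add: mdist_commute abs_le_iff)


lemma mdist_self [simp]: "x \<in> mspace X \<Longrightarrow> mdist X x x = 0"
  by simp

section \<open>Coloured partitions at a fixed scale\<close>

lemma mdiam_le_iff: "mdiam X A \<le> ereal D \<longleftrightarrow> (\<forall>x\<in>A. \<forall>y\<in>A. mdist X x y \<le> D)"
  by (auto simp: mdiam_def SUP_le_iff)

text \<open>The dimension and the multiplicity are infima of sets of integers, hence attained; comparing with
the next integer extracts a witness. Since a point lies in at least one member of a covering, the
multiplicity is at least \<open>1\<close>, and so \<open>n\<close> is nonnegative.\<close>

lemma nagata_coverings:
  fixes X :: "'a metric"
  assumes dim: "nagata_dim X \<le> ereal (real_of_int n)" and ne: "mspace X \<noteq> {}"
  obtains c where "0 \<le> n" "c > 0"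
    "\<And>s. s > 0 \<Longrightarrow> \<exists>I (B :: 'a set \<Rightarrow> 'a set). covering X I B \<and> D_bounded X (c * s) I B \<and>
       (\<forall>A\<subseteq>mspace X. mdiam X A \<le> ereal s \<longrightarrow> meets_at_most (nat (n + 1)) I B A)"
proof -
  have "nagata_dim X < ereal (real_of_int (n + 1))"
    using dim by (rule le_less_trans) simp
  then obtain n' where n': "nagata_dim_prop X n'" "n' \<le> n"
    unfolding nagata_dim_def Inf_less_iff by auto
  then obtain c where c: "c > 0" and cov: "\<And>s. s > 0 \<Longrightarrow> \<exists>I (B :: 'a set \<Rightarrow> 'a set).
        covering X I B \<and> D_bounded X (c * s) I B \<and>
        multiplicity_at_scale X s I B \<le> ereal (real_of_int (n' + 1))"
    unfolding nagata_dim_prop_def by blast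
  have main: "\<exists>I (B :: 'a set \<Rightarrow> 'a set). covering X I B \<and> D_bounded X (c * s) I B \<and>
       (\<forall>A\<subseteq>mspace X. mdiam X A \<le> ereal s \<longrightarrow> meets_at_most (nat (n + 1)) I B A) \<and> 0 \<le> n"
    if s: "s > 0" for s
  proof -
    obtain I and B :: "'a set \<Rightarrow> 'a set" where IB: "covering X I B" "D_bounded X (c * s) I B"
      "multiplicity_at_scale X s I B \<le> ereal (real_of_int (n' + 1))" using cov[OF s] by blast
    have "multiplicity_at_scale X s I B < ereal (real_of_int (n' + 2))"
      using IB(3) by (rule le_less_trans) simp
    then obtain m :: nat where m: "real m < real_of_int (n' + 2)"
      "\<And>A. A \<subseteq> mspace X \<Longrightarrow> mdiam X A \<le> ereal s \<Longrightarrow> meets_at_most m I B A"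
      unfolding multiplicity_at_scale_def Inf_less_iff by auto
    have mn: "m \<le> nat (n + 1)"
      using m(1) n'(2) by linarith
    obtain x where x: "x \<in> mspace X" using ne by blast
    then obtain i where i: "i \<in> I" "x \<in> B i"
      using IB(1) unfolding covering_def by blast
    have "meets_at_most m I B {x}"
      using x s by (intro m(2)) (auto simp: mdiam_le_iff)
    then have fin: "finite {i \<in> I. {x} \<inter> B i \<noteq> {}}" and le: "card {i \<in> I. {x} \<inter> B i \<noteq> {}} \<le> m"
      unfolding meets_at_most_def by blast+
    have "i \<in> {i \<in> I. {x} \<inter> B i \<noteq> {}}" using i by blast
    then have "card {i \<in> I. {x} \<inter> B i \<noteq> {}} > 0" using fin card_gt_0_iff by blast
    then have "m \<ge> 1" using le by linarith
    then have "0 \<le> n" using mn by linarith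
    moreover have "meets_at_most (nat (n + 1)) I B A" if "A \<subseteq> mspace X" "mdiam X A \<le> ereal s" for A
      using m(2)[OF that] mn by (auto simp: meets_at_most_def)
    ultimately show ?thesis using IB by blast
  qed
  from main[of 1] have "0 \<le> n" by auto
  then show thesis using that[OF _ c] main by blast
qed

text \<open>A partition is encoded by two labellings: its pieces are the sets on which both the colour \<open>\<kappa>\<close> and
the label \<open>l\<close> are constant. Pieces of different colours may touch.\<close>

definition separated_colouring ::
    "'a metric \<Rightarrow> nat \<Rightarrow> real \<Rightarrow> real \<Rightarrow> ('a \<Rightarrow> nat) \<Rightarrow> ('a \<Rightarrow> 'l) \<Rightarrow> bool" where
  "separated_colouring X n c s \<kappa> l \<longleftrightarrow>
     (\<forall>x\<in>mspace X. \<kappa> x \<le> n) \<and>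
     (\<forall>x\<in>mspace X. \<forall>y\<in>mspace X. \<kappa> x = \<kappa> y \<longrightarrow>
        (if l x = l y then mdist X x y \<le> c * s else s \<le> mdist X x y))"

text \<open>The \<open>N\<close> intervals \<open>((t - 1) \<delta>, t \<delta>)\<close> cannot all contain a value of \<open>\<sigma>\<close>: one of the at most \<open>N\<close>
values is \<open>N \<delta>\<close>, which lies in none of them.\<close>

lemma exists_gap:
  fixes \<sigma> :: "'i \<Rightarrow> real"
  assumes T: "finite T" "card T \<le> N" "i0 \<in> T" and \<delta>: "\<delta> > 0"
    and top: "\<sigma> i0 = real N * \<delta>"
  shows "\<exists>t. 0 < t \<and> t \<le> N \<and> (\<forall>i\<in>T. \<sigma> i \<ge> real t * \<delta> \<or> \<sigma> i \<le> (real t - 1) * \<delta>)"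
proof (rule ccontr)
  assume no: "\<not> ?thesis"
  have "\<exists>i. i \<in> T \<and> \<sigma> i < real t * \<delta> \<and> \<sigma> i > (real t - 1) * \<delta>" if "t \<in> {1..N}" for t
  proof (rule ccontr)
    assume "\<nexists>i. i \<in> T \<and> \<sigma> i < real t * \<delta> \<and> \<sigma> i > (real t - 1) * \<delta>"
    then have "\<forall>i\<in>T. \<sigma> i \<ge> real t * \<delta> \<or> \<sigma> i \<le> (real t - 1) * \<delta>" by (meson not_le)
    moreover have "0 < t" "t \<le> N" using that by auto
    ultimately show False using no by blast
  qed
  then obtain w where w: "\<And>t. t \<in> {1..N} \<Longrightarrow> w t \<in> T \<and> \<sigma> (w t) < real t * \<delta> \<and> \<sigma> (w t) > (real t - 1) * \<delta>"
    by metis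
  have lt: False if "t \<in> {1..N}" "u \<in> {1..N}" "w t = w u" "t < u" for t u
  proof -
    have "real t * \<delta> \<le> (real u - 1) * \<delta>"
      using that(4) \<delta> by (intro mult_right_mono) auto
    then show False using w[OF that(1)] w[OF that(2)] that(3) by auto
  qed
  have "inj_on w {1..N}"
    by (rule inj_onI) (metis lt nat_neq_iff)
  moreover have "w ` {1..N} \<subseteq> T - {i0}"
  proof
    fix i assume "i \<in> w ` {1..N}"
    then obtain t where t: "t \<in> {1..N}" "i = w t" by blast
    have "real t * \<delta> \<le> real N * \<delta>" using t \<delta> by (intro mult_right_mono) auto
    then show "i \<in> T - {i0}" using w[OF t(1)] t(2) top by auto
  qed
  ultimately have "card {1..N} \<le> card (T - {i0})"
    using T(1) by (metis card_inj_on_le finite_Diff)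
  moreover have "card (T - {i0}) < card T" using T by (meson card_Diff1_less)
  ultimately show False using T(2) by simp
qed

text \<open>Let \<open>\<sigma> i x\<close> be the depth of \<open>x\<close> in the \<open>s/2\<close>-neighbourhood of \<open>B i\<close>. At each \<open>x\<close> the depths
descend from \<open>s/2\<close> to \<open>0\<close> within \<open>n + 1\<close> indices, hence they have a gap of \<open>\<delta> = s / (2 (n + 1))\<close>.
The label of \<open>x\<close> is the set \<open>J x\<close> of indices above such a gap and its colour is the size of \<open>J x\<close>
minus one. If \<open>J x\<close> and \<open>J y\<close> are different and of equal size, then each contains an index missing
from the other, and passing from \<open>x\<close> to \<open>y\<close> reverses the order of the two depths across gaps of
\<open>\<delta>\<close>; since depths are \<open>1\<close>-Lipschitz, \<open>x\<close> and \<open>y\<close> are at least \<open>\<delta>\<close> apart. If \<open>J x = J y\<close>, both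
points are within \<open>s/2\<close> of one member of the covering.\<close>

lemma separated_colouring_of_covering:
  fixes X :: "'a metric" and B :: "'i \<Rightarrow> 'a set"
  assumes cov: "covering X I B" and bd: "D_bounded X (c * s) I B"
    and mult: "\<And>A. A \<subseteq> mspace X \<Longrightarrow> mdiam X A \<le> ereal s \<Longrightarrow> meets_at_most (Suc n) I B A"
    and s: "s > 0" and c: "c > 0"
  shows "\<exists>\<kappa> (l :: 'a \<Rightarrow> 'i set).
    separated_colouring X n (2 * real (Suc n) * (c + 1)) (s / (2 * real (Suc n))) \<kappa> l"
proof -
  define N where "N = Suc n"
  define \<delta> where "\<delta> = s / (2 * real N)"
  \<comment> \<open>The distance to an empty member carries no information, so such members are discarded.\<close>
  define I' where "I' = {i \<in> I. B i \<noteq> {}}"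
  define \<sigma> where "\<sigma> i x = max 0 (s / 2 - dist_set X (B i) x)" for i x
  have N: "N > 0" and \<delta>: "\<delta> > 0" and N\<delta>: "real N * \<delta> = s / 2"
    using s by (simp_all add: N_def \<delta>_def field_simps)
  have BX: "B i \<subseteq> mspace X" if "i \<in> I'" for i
    using cov that by (auto simp: covering_def I'_def)
  have Bne: "B i \<noteq> {}" if "i \<in> I'" for i using that by (auto simp: I'_def)
  have near: "\<exists>b\<in>B i. mdist X x b < s / 2" if "i \<in> I'" "\<sigma> i x > 0" for i x
    using dist_set_less_imp[OF Bne[OF that(1)], where X = X and x = x and r = "s / 2"] that(2) by (auto simp: \<sigma>_def max_def split: if_splits)
  have \<sigma>lip: "\<sigma> i x - \<sigma> i y \<le> mdist X x y" if "i \<in> I'" "x \<in> mspace X" "y \<in> mspace X" for i x y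
    using dist_set_abs_diff_le[OF Bne[OF that(1)] BX[OF that(1)] that(2,3)]
    by (auto simp: \<sigma>_def max_def abs_le_iff)
  have ex: "\<exists>J. J \<subseteq> I' \<and> finite J \<and> J \<noteq> {} \<and> card J \<le> N \<and> (\<forall>j\<in>J. \<sigma> j x > 0) \<and>
      (\<forall>j\<in>J. \<forall>i\<in>I' - J. \<sigma> j x \<ge> \<sigma> i x + \<delta>)" if x: "x \<in> mspace X" for x
  proof -
    define T where "T = {i \<in> I'. \<sigma> i x > 0}"
    let ?A = "{y \<in> mspace X. mdist X x y < s / 2}"
    have "mdist X y z \<le> s" if "y \<in> ?A" "z \<in> ?A" for y z
      using mdist_triangle[of y X x z] that x by (simp add: mdist_commute)
    then have mA: "meets_at_most N I B ?A"
      unfolding N_def by (intro mult) (auto simp: mdiam_le_iff)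
    have sub: "T \<subseteq> {i \<in> I. ?A \<inter> B i \<noteq> {}}"
      using near BX by (fastforce simp: T_def I'_def)
    have mA': "finite {i \<in> I. ?A \<inter> B i \<noteq> {}}" "card {i \<in> I. ?A \<inter> B i \<noteq> {}} \<le> N"
      using mA unfolding meets_at_most_def by blast+
    have T: "finite T" "card T \<le> N"
      using finite_subset[OF sub mA'(1)] card_mono[OF mA'(1) sub] mA'(2) by simp_all
    obtain i0 where i0: "i0 \<in> I" "x \<in> B i0"
      using cov x unfolding covering_def by blast
    have i0': "i0 \<in> I'" using i0 by (auto simp: I'_def)
    have "dist_set X (B i0) x = 0"
      using dist_set_le[OF i0(2), of X x] dist_set_nonneg[OF Bne[OF i0'], of X x] x by simp
    then have top: "\<sigma> i0 x = real N * \<delta>" using s N\<delta> by (simp add: \<sigma>_def)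
    have i0T: "i0 \<in> T" using i0' s N\<delta> top by (simp add: T_def)
    obtain t where t: "0 < t" "t \<le> N"
      "\<And>i. i \<in> T \<Longrightarrow> \<sigma> i x \<ge> real t * \<delta> \<or> \<sigma> i x \<le> (real t - 1) * \<delta>"
      using exists_gap[where \<sigma> = "\<lambda>i. \<sigma> i x", OF T i0T \<delta> top] by blast
    define J where "J = {i \<in> T. \<sigma> i x \<ge> real t * \<delta>}"
    have "i0 \<in> J" using i0T top t(2) \<delta> by (auto simp: J_def)
    moreover have "\<sigma> j x \<ge> \<sigma> i x + \<delta>" if "j \<in> J" "i \<in> I' - J" for i j
    proof -
      have "\<sigma> i x \<le> (real t - 1) * \<delta>"
      proof (cases "i \<in> T")
        case True then show ?thesis using t(3)[OF True] that(2) by (auto simp: J_def)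
      next
        case False
        then have "\<sigma> i x = 0" using that(2) by (auto simp: T_def \<sigma>_def max_def)
        then show ?thesis using t(1) \<delta> by simp
      qed
      then show ?thesis using that(1) by (auto simp: J_def algebra_simps)
    qed
    moreover have "J \<subseteq> T" by (auto simp: J_def)
    then have "finite J" "card J \<le> N" 
      using T card_mono[of T J] finite_subset[of J T] by simp_all
    moreover have "J \<subseteq> I'" "\<forall>j\<in>J. \<sigma> j x > 0" by (auto simp: J_def T_def)
    ultimately show ?thesis by blast
  qed
  then obtain J where J: "\<And>x. x \<in> mspace X \<Longrightarrow> J x \<subseteq> I' \<and> finite (J x) \<and> J x \<noteq> {} \<and> card (J x) \<le> N \<and>
      (\<forall>j\<in>J x. \<sigma> j x > 0) \<and> (\<forall>j\<in>J x. \<forall>i\<in>I' - J x. \<sigma> j x \<ge> \<sigma> i x + \<delta>)"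
    by metis
  have same: "mdist X x y \<le> (c + 1) * s" if xy: "x \<in> mspace X" "y \<in> mspace X" and eq: "J x = J y" for x y
  proof -
    obtain j where j: "j \<in> J x" using J[OF xy(1)] by blast
    then have jI: "j \<in> I'" using J[OF xy(1)] by blast
    obtain b where b: "b \<in> B j" "mdist X x b < s / 2"
      using near[OF jI] J[OF xy(1)] j by blast
    obtain b' where b': "b' \<in> B j" "mdist X y b' < s / 2"
      using near[OF jI] J[OF xy(2)] j eq by blast
    have "mdist X b b' \<le> c * s"
      using bd jI b(1) b'(1) by (auto simp: D_bounded_def mdiam_le_iff I'_def)
    moreover have "mdist X x y \<le> mdist X x b + mdist X b y" "mdist X b y \<le> mdist X b b' + mdist X b' y"
      using mdist_triangle xy b(1) b'(1) BX[OF jI] by (metis subsetD)+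
    ultimately show ?thesis using b(2) b'(2) by (simp add: mdist_commute algebra_simps)
  qed
  have diff: "\<delta> \<le> mdist X x y"
    if xy: "x \<in> mspace X" "y \<in> mspace X" and ne: "J x \<noteq> J y" and cd: "card (J x) = card (J y)" for x y
  proof -
    have "\<not> J x \<subseteq> J y" "\<not> J y \<subseteq> J x"
      using card_subset_eq J[OF xy(1)] J[OF xy(2)] ne cd by metis+
    then obtain i j where ij: "i \<in> J x" "i \<notin> J y" "j \<in> J y" "j \<notin> J x" by blast
    then have I: "i \<in> I'" "j \<in> I'" using J[OF xy(1)] J[OF xy(2)] by auto
    have "\<sigma> i x \<ge> \<sigma> j x + \<delta>" "\<sigma> j y \<ge> \<sigma> i y + \<delta>"
      using J[OF xy(1)] J[OF xy(2)] ij I by auto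
    then show ?thesis
      using \<sigma>lip[OF I(1) xy] \<sigma>lip[OF I(2) xy(2,1)] by (simp add: mdist_commute)
  qed
  have "separated_colouring X n (2 * real (Suc n) * (c + 1)) (s / (2 * real (Suc n))) (\<lambda>x. card (J x) - 1) J"
    unfolding separated_colouring_def
  proof (intro conjI ballI impI)
    fix x assume "x \<in> mspace X"
    then have "card (J x) \<le> Suc n" using J N_def by blast
    then show "card (J x) - 1 \<le> n" by simp
  next
    fix x y assume xy: "x \<in> mspace X" "y \<in> mspace X" and "card (J x) - 1 = card (J y) - 1"
    moreover have "card (J x) > 0" "card (J y) > 0" using J xy by (simp_all add: card_gt_0_iff)
    ultimately have cd: "card (J x) = card (J y)" by linarith
    have "2 * real (Suc n) * (c + 1) * (s / (2 * real (Suc n))) = (c + 1) * s"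
      by (simp del: of_nat_Suc)
    then show "if J x = J y then mdist X x y \<le> 2 * real (Suc n) * (c + 1) * (s / (2 * real (Suc n)))
          else s / (2 * real (Suc n)) \<le> mdist X x y"
      using same[OF xy] diff[OF xy _ cd] by (auto simp: \<delta>_def N_def)
  qed
  then show ?thesis by blast
qed

lemma nagata_colourings:
  fixes X :: "'a metric"
  assumes dim: "nagata_dim X \<le> ereal (real_of_int n)" and ne: "mspace X \<noteq> {}"
  obtains c where "0 \<le> n" "c > 0"
    "\<And>s. s > 0 \<Longrightarrow> \<exists>\<kappa> (l :: 'a \<Rightarrow> 'a set set). separated_colouring X (nat n) c s \<kappa> l"
proof -
  obtain c where n: "0 \<le> n" and c: "c > 0" and cov:
    "\<And>s. s > 0 \<Longrightarrow> \<exists>I (B :: 'a set \<Rightarrow> 'a set). covering X I B \<and> D_bounded X (c * s) I B \<and>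
       (\<forall>A\<subseteq>mspace X. mdiam X A \<le> ereal s \<longrightarrow> meets_at_most (nat (n + 1)) I B A)"
    by (metis nagata_coverings[OF dim ne])
  have nn: "nat (n + 1) = Suc (nat n)" using n by auto
  show thesis
  proof (rule that[of "2 * real (Suc (nat n)) * (c + 1)"])
    fix s :: real assume s: "s > 0"
    define s' where "s' = 2 * real (Suc (nat n)) * s"
    have s': "s' > 0" "s' / (2 * real (Suc (nat n))) = s" using s by (auto simp: s'_def)
    obtain I and B :: "'a set \<Rightarrow> 'a set" where IB: "covering X I B" "D_bounded X (c * s') I B"
       "\<And>A. A \<subseteq> mspace X \<Longrightarrow> mdiam X A \<le> ereal s' \<Longrightarrow> meets_at_most (Suc (nat n)) I B A"
      using cov[OF s'(1)] nn by metis
    show "\<exists>\<kappa> (l :: 'a \<Rightarrow> 'a set set).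
        separated_colouring X (nat n) (2 * real (Suc (nat n)) * (c + 1)) s \<kappa> l"
      using separated_colouring_of_covering[OF IB s'(1) c] s'(2) by simp
  qed (use n c in auto)
qed


section \<open>Coloured partitions of Whitney type\<close>

text \<open>The same kind of partition for the region \<open>\<rho> > 0\<close>, with the variable scale \<open>\<rho>\<close> instead of a
fixed one.\<close>

definition whitney_colouring ::
    "'a metric \<Rightarrow> nat \<Rightarrow> real \<Rightarrow> real \<Rightarrow> ('a \<Rightarrow> real) \<Rightarrow> ('a \<Rightarrow> nat) \<Rightarrow> ('a \<Rightarrow> 'l) \<Rightarrow> bool" where
  "whitney_colouring X n a b \<rho> \<kappa> l \<longleftrightarrow>
     (\<forall>x\<in>mspace X. 0 < \<rho> x \<longrightarrow> \<kappa> x \<le> n) \<and>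
     (\<forall>x\<in>mspace X. \<forall>y\<in>mspace X. 0 < \<rho> x \<and> 0 < \<rho> y \<and> \<kappa> x = \<kappa> y \<longrightarrow>
        (if l x = l y then mdist X x y \<le> a * \<rho> x else b * \<rho> x \<le> mdist X x y))"

text \<open>The annulus \<open>2\<^sup>j \<le> \<rho> < 2\<^sup>j\<^sup>+\<^sup>1\<close> is partitioned at scale \<open>2\<^sup>j\<close> if \<open>j\<close> is even, and at the finer scale
\<open>\<epsilon> 2\<^sup>j\<close> if \<open>j\<close> is odd. Annuli of equal parity are far from each other, so separation can fail only
between a fine piece and a coarse piece of the same colour in adjacent annuli. Every fine piece
close to such a coarse piece is absorbed by it. Fine pieces are so small that they are close to at
most one coarse piece; hence absorption is unambiguous, it enlarges pieces only by a bounded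
factor, and it leaves pieces of one colour separated at the fine scale.\<close>

lemma whitney_colouring_exists:
  fixes X :: "'a metric"
  assumes col: "\<And>s. s > 0 \<Longrightarrow> \<exists>\<kappa> (l :: 'a \<Rightarrow> 'l). separated_colouring X n c s \<kappa> l"
    and c: "c > 0"
    and \<rho>: "\<And>x y. x \<in> mspace X \<Longrightarrow> y \<in> mspace X \<Longrightarrow> \<bar>\<rho> x - \<rho> y\<bar> \<le> mdist X x y"
  shows "\<exists>\<kappa> (l :: 'a \<Rightarrow> int \<times> 'l). whitney_colouring X n (2 * c + 2) (1 / (16 * (c + 2))) \<rho> \<kappa> l"
proof -
  \<comment> \<open>With this choice a fine piece and two gaps of size \<open>\<epsilon> 2\<^sup>j\<close> fit into a length of \<open>2\<^sup>j / 4\<close>.\<close>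
  define \<epsilon> where "\<epsilon> = 1 / (4 * (c + 2))"
  define r where "r i = 2 powr real_of_int i" for i :: int
  define sc where "sc i = (if even i then 1 else \<epsilon>) * r i" for i :: int
  define U where "U = {x \<in> mspace X. 0 < \<rho> x}"
  define j where "j x = \<lfloor>log 2 (\<rho> x)\<rfloor>" for x
  have \<epsilon>: "\<epsilon> > 0" "(c + 2) * \<epsilon> = 1 / 4" "\<epsilon> \<le> 1 / 8"
    using c by (auto simp: \<epsilon>_def field_simps)
  have \<epsilon>_split: "c * (\<epsilon> * t) + 2 * (\<epsilon> * t) = t / 4" for t
  proof -
    have "c * (\<epsilon> * t) + 2 * (\<epsilon> * t) = ((c + 2) * \<epsilon>) * t" by (simp add: algebra_simps)
    then show ?thesis using \<epsilon>(2) by simp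
  qed
  have r_pos: "r i > 0" for i by (simp add: r_def)
  have r_less: "2 * r i \<le> r i'" if "i < i'" for i i'
  proof -
    have "2 * r i = 2 powr (real_of_int i + 1)" by (simp add: r_def powr_add)
    also have "\<dots> \<le> r i'" unfolding r_def using that by (intro powr_mono) auto
    finally show ?thesis .
  qed
  have sc_pos: "sc i > 0" and sc_le: "sc i \<le> r i" for i
    using \<epsilon> r_pos[of i] by (auto simp: sc_def)
  have jr: "r (j x) \<le> \<rho> x" "\<rho> x < 2 * r (j x)" if "x \<in> U" for x
  proof -
    have pos: "\<rho> x > 0" using that by (simp add: U_def)
    have "r (j x) \<le> 2 powr (log 2 (\<rho> x))"
      unfolding r_def j_def by (intro powr_mono) auto
    then show "r (j x) \<le> \<rho> x" using pos by simp
    have "2 powr (log 2 (\<rho> x)) < 2 powr (real_of_int (j x) + 1)"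
      unfolding j_def by (intro powr_less_mono) linarith+
    then show "\<rho> x < 2 * r (j x)" using pos by (simp add: r_def powr_add)
  qed
  have tri: "mdist X x z \<le> mdist X x y + mdist X y z" if "x \<in> U" "y \<in> U" "z \<in> U" for x y z
    using that by (intro mdist_triangle) (auto simp: U_def)
  have \<rho>U: "\<rho> x \<le> \<rho> y + mdist X x y" "\<rho> y \<le> \<rho> x + mdist X x y" if "x \<in> U" "y \<in> U" for x y
    using \<rho>[of x y] that by (auto simp: U_def abs_le_iff)
  have "\<exists>\<kappa> (l :: 'a \<Rightarrow> 'l). separated_colouring X n c (sc i) \<kappa> l" for i
    using col sc_pos by blast
  then obtain \<kappa>' and l' :: "int \<Rightarrow> 'a \<Rightarrow> 'l"
    where kl: "\<And>i. separated_colouring X n c (sc i) (\<kappa>' i) (l' i)" by metis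
  define \<kappa> where "\<kappa> x = \<kappa>' (j x) x" for x
  define l0 where "l0 x = (j x, l' (j x) x)" for x
  have jl0: "j x = j y" if "l0 x = l0 y" for x y using that by (simp add: l0_def)
  have same0: "mdist X x y \<le> c * sc (j x)" if "x \<in> U" "y \<in> U" "\<kappa> x = \<kappa> y" "l0 x = l0 y" for x y
  proof -
    have "x \<in> mspace X" "y \<in> mspace X" "\<kappa>' (j x) x = \<kappa>' (j x) y" "l' (j x) x = l' (j x) y"
      using that by (auto simp add: U_def \<kappa>_def l0_def)
    then show ?thesis using kl[of "j x"] unfolding separated_colouring_def by metis
  qed
  have diff0: "sc (j x) \<le> mdist X x y"
    if "x \<in> U" "y \<in> U" "\<kappa> x = \<kappa> y" "j x = j y" "l0 x \<noteq> l0 y" for x y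
  proof -
    have "x \<in> mspace X" "y \<in> mspace X" "\<kappa>' (j x) x = \<kappa>' (j x) y" "l' (j x) x \<noteq> l' (j x) y"
      using that by (simp_all add: U_def \<kappa>_def l0_def)
    then show ?thesis using kl[of "j x"] unfolding separated_colouring_def by metis
  qed
  \<comment> \<open>\<open>W x\<close> consists of the points of coarse pieces close to the piece of \<open>x\<close>, and \<open>A x\<close> is a
      point of the piece that absorbs \<open>x\<close>, or \<open>x\<close> itself.\<close>
  define W where "W x = {v \<in> U. even (j v) \<and> \<kappa> v = \<kappa> x \<and>
      (\<exists>y\<in>U. \<kappa> y = \<kappa> x \<and> l0 y = l0 x \<and> mdist X y v < \<epsilon> * r (j x))}" for x
  define A where "A x = (if odd (j x) \<and> W x \<noteq> {} then SOME v. v \<in> W x else x)" for x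
  have AW: "A x \<in> W x" if "odd (j x)" "W x \<noteq> {}" for x
    using that by (simp add: A_def some_in_eq)
  have W_cong: "W x = W y" if "\<kappa> x = \<kappa> y" "l0 x = l0 y" for x y
    using that jl0[OF that(2)] by (simp add: W_def)
  have W_uniq: "l0 v = l0 v'" if x: "x \<in> U" "odd (j x)" and v: "v \<in> W x" and v': "v' \<in> W x" for x v v'
  proof (rule ccontr)
    assume ne: "l0 v \<noteq> l0 v'"
    let ?i = "j x"
    obtain y where y: "y \<in> U" "\<kappa> y = \<kappa> x" "l0 y = l0 x" "mdist X y v < \<epsilon> * r ?i"
      using v by (auto simp: W_def)
    obtain y' where y': "y' \<in> U" "\<kappa> y' = \<kappa> x" "l0 y' = l0 x" "mdist X y' v' < \<epsilon> * r ?i"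
      using v' by (auto simp: W_def)
    have vU: "v \<in> U" "even (j v)" "\<kappa> v = \<kappa> x" "v' \<in> U" "even (j v')" "\<kappa> v' = \<kappa> x"
      using v v' by (auto simp: W_def)
    have jy: "j y = ?i" "j y' = ?i" using jl0[OF y(3)] jl0[OF y'(3)] by auto
    have "mdist X y y' \<le> c * (\<epsilon> * r ?i)"
      using same0[of y y'] y y' jy x(2) by (simp add: sc_def)
    moreover have "mdist X v v' \<le> mdist X y v + mdist X y y' + mdist X y' v'"
      using tri[of v y v'] tri[of y y' v'] y y' vU by (simp add: mdist_commute)
    moreover have "c * (\<epsilon> * r ?i) + 2 * (\<epsilon> * r ?i) = r ?i / 4"
      by (rule \<epsilon>_split)
    ultimately have d: "mdist X v v' < r ?i / 4"
      using y(4) y'(4) by linarith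
    have \<epsilon>r: "\<epsilon> * r ?i \<le> r ?i / 8" using \<epsilon>(3) r_pos[of ?i] by simp
    have adj: "?i - 1 \<le> j w \<and> j w \<le> ?i + 1" if "w \<in> U" "u \<in> U" "j u = ?i" "mdist X u w < \<epsilon> * r ?i" for u w
    proof -
      have \<rho>w: "\<rho> w \<ge> r ?i - \<epsilon> * r ?i" "\<rho> w < 2 * r ?i + \<epsilon> * r ?i"
        using \<rho>U[OF that(2,1)] jr[OF that(2)] that(3,4) by auto
      have "\<not> j w < ?i - 1"
      proof
        assume "j w < ?i - 1"
        then have "2 * r (j w) \<le> r (?i - 1)" "2 * r (?i - 1) \<le> r ?i" by (auto intro: r_less)
        then show False using jr[OF that(1)] \<rho>w \<epsilon>r r_pos[of ?i] by linarith
      qed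
      moreover have "\<not> j w > ?i + 1"
      proof
        assume "j w > ?i + 1"
        then have "2 * r (?i + 1) \<le> r (j w)" "2 * r ?i \<le> r (?i + 1)" by (auto intro: r_less)
        then show False using jr[OF that(1)] \<rho>w \<epsilon>r r_pos[of ?i] by linarith
      qed
      ultimately show ?thesis by linarith
    qed
    have "j v \<noteq> ?i" "j v' \<noteq> ?i" using x(2) vU by auto
    then have cs: "j v = ?i - 1 \<or> j v = ?i + 1" "j v' = ?i - 1 \<or> j v' = ?i + 1"
      using adj[OF vU(1) y(1) jy(1) y(4)] adj[OF vU(4) y'(1) jy(2) y'(4)] by auto
    have far: False if "w \<in> U" "w' \<in> U" "j w = ?i - 1" "j w' = ?i + 1" "mdist X w w' < r ?i / 4" for w w'
    proof -
      have "2 * r (?i - 1) \<le> r ?i" "2 * r ?i \<le> r (?i + 1)" by (auto intro: r_less)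
      then show False
        using jr[OF that(1)] jr[OF that(2)] \<rho>U[OF that(1,2)] that(3-5) r_pos[of ?i] by auto
    qed
    have jvv: "j v = j v'"
      using cs far[OF vU(1,4)] far[OF vU(4,1)] d by (auto simp: mdist_commute)
    have "r ?i \<le> 2 * r (j v)"
    proof -
      have "r ?i = 2 * r (?i - 1)" by (simp add: r_def powr_diff)
      moreover have "2 * r ?i \<le> r (?i + 1)" by (auto intro: r_less)
      ultimately show ?thesis using cs(1) r_pos[of ?i] by auto
    qed
    moreover have "r (j v) \<le> mdist X v v'"
      using diff0[OF vU(1,4) _ jvv ne] vU by (simp add: sc_def)
    ultimately show False using d r_pos[of ?i] by linarith
  qed
  define l where "l x = l0 (A x)" for x
  have A_near: "A x \<in> U \<and> \<kappa> (A x) = \<kappa> x \<and> mdist X x (A x) \<le> \<rho> x / 4" if x: "x \<in> U" for x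
  proof (cases "odd (j x) \<and> W x \<noteq> {}")
    case True
    then obtain y where y: "y \<in> U" "\<kappa> y = \<kappa> x" "l0 y = l0 x" "mdist X y (A x) < \<epsilon> * r (j x)"
      and AU: "A x \<in> U" "\<kappa> (A x) = \<kappa> x" using AW[of x] by (auto simp: W_def)
    have "mdist X x y \<le> c * (\<epsilon> * r (j x))"
      using same0[of x y] y x True by (simp add: sc_def)
    moreover have "c * (\<epsilon> * r (j x)) + 2 * (\<epsilon> * r (j x)) = r (j x) / 4"
      by (rule \<epsilon>_split)
    moreover have "\<epsilon> * r (j x) > 0" using \<epsilon> r_pos by simp
    ultimately have "mdist X x (A x) \<le> r (j x) / 4"
      using tri[OF x y(1) AU(1)] y(4) by linarith
    then show ?thesis using AU jr[OF x] by linarith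
  next
    case False
    then have "A x = x" by (auto simp: A_def)
    then show ?thesis using x by (auto simp: U_def)
  qed
  have "whitney_colouring X n (2 * c + 2) (1 / (16 * (c + 2))) \<rho> \<kappa> l"
    unfolding whitney_colouring_def
  proof (intro conjI ballI impI)
    fix x assume "x \<in> mspace X"
    then show "\<kappa> x \<le> n" using kl by (auto simp: separated_colouring_def \<kappa>_def)
  next
    fix x y assume "x \<in> mspace X" "y \<in> mspace X" and "0 < \<rho> x \<and> 0 < \<rho> y \<and> \<kappa> x = \<kappa> y"
    then have xy: "x \<in> U" "y \<in> U" and kxy: "\<kappa> x = \<kappa> y" by (auto simp: U_def)
    have same: "mdist X x y \<le> (2 * c + 2) * \<rho> x" if eq: "l x = l y"
    proof -
      note Ax = A_near[OF xy(1)] and Ay = A_near[OF xy(2)]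
      have jA: "j (A x) = j (A y)" using eq by (intro jl0) (simp add: l_def)
      have "mdist X (A x) (A y) \<le> c * sc (j (A x))"
        using same0[of "A x" "A y"] Ax Ay kxy eq by (auto simp: l_def)
      moreover have "r (j (A x)) \<le> 5 / 4 * \<rho> x"
        using jr(1)[of "A x"] \<rho>U[of x "A x"] Ax xy by auto
      moreover have "c * sc (j (A x)) \<le> c * (5 / 4 * \<rho> x)"
        using sc_le[of "j (A x)"] calculation(2) c by (intro mult_left_mono) auto
      moreover have "\<rho> y \<le> 10 / 3 * \<rho> x"
        using jr(2)[of "A y"] \<rho>U[of y "A y"] Ay xy calculation(2) jA by auto
      moreover have "mdist X x y \<le> mdist X x (A x) + mdist X (A x) (A y) + mdist X y (A y)"
        using tri[of x "A x" y] tri[of "A x" "A y" y] Ax Ay xy by (simp add: mdist_commute)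
      moreover have "c * \<rho> x > 0" "\<rho> x > 0" using c xy by (auto simp: U_def)
      ultimately show ?thesis
        using Ax Ay by (simp add: algebra_simps)
    qed
    have diff: "1 / (16 * (c + 2)) * \<rho> x \<le> mdist X x y" if ne: "l x \<noteq> l y"
    proof (rule ccontr)
      assume "\<not> ?thesis"
      then have "mdist X x y < 1 / (16 * (c + 2)) * \<rho> x" by (simp only: not_le)
      moreover have "1 / (16 * (c + 2)) = \<epsilon> / 4" using c by (simp add: \<epsilon>_def field_simps)
      ultimately have d: "mdist X x y < \<epsilon> / 4 * \<rho> x" by (simp only:)
      have \<rho>p: "\<rho> x > 0" "\<rho> y > 0" using xy by (auto simp: U_def)
      have \<epsilon>\<rho>: "\<epsilon> * \<rho> x \<le> \<rho> x / 8" "\<epsilon> * \<rho> x > 0" using \<epsilon> \<rho>p by auto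
      have \<rho>xy: "\<rho> y \<ge> 31 / 32 * \<rho> x" "\<rho> y \<le> 33 / 32 * \<rho> x"
        using \<rho>U[OF xy] d \<epsilon>\<rho> \<rho>p by linarith+
      have jadj: "\<bar>j x - j y\<bar> \<le> 1"
      proof (rule ccontr)
        assume "\<not> ?thesis"
        then consider "j x + 1 < j y" | "j y + 1 < j x" by linarith
        then show False
        proof cases
          case 1
          then have "2 * r (j x + 1) \<le> r (j y)" "2 * r (j x) \<le> r (j x + 1)" by (auto intro: r_less)
          then show False using jr[OF xy(1)] jr[OF xy(2)] \<rho>xy \<rho>p by linarith
        next
          case 2
          then have "2 * r (j y + 1) \<le> r (j x)" "2 * r (j y) \<le> r (j y + 1)" by (auto intro: r_less)
          then show False using jr[OF xy(1)] jr[OF xy(2)] \<rho>xy \<rho>p by linarith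
        qed
      qed
      have \<epsilon>r: "mdist X x y < \<epsilon> * r (j x)" "mdist X x y < \<epsilon> * r (j y)"
      proof -
        have "\<rho> x < 4 * r (j x)" "\<rho> x < 4 * r (j y)"
          using jr[OF xy(1)] jr[OF xy(2)] \<rho>xy \<rho>p by linarith+
        then have "\<epsilon> * \<rho> x < \<epsilon> * (4 * r (j x))" "\<epsilon> * \<rho> x < \<epsilon> * (4 * r (j y))"
          using \<epsilon>(1) by simp_all
        then show "mdist X x y < \<epsilon> * r (j x)" "mdist X x y < \<epsilon> * r (j y)"
          using d by auto
      qed
      have \<epsilon>sc: "\<epsilon> * r i \<le> sc i" for i using \<epsilon> r_pos[of i] by (auto simp: sc_def)
      have mixed: "l0 (A u) = l0 v"
        if "u \<in> U" "v \<in> U" "odd (j u)" "even (j v)" "\<kappa> u = \<kappa> v" "mdist X u v < \<epsilon> * r (j u)" for u v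
      proof -
        have "v \<in> W u" using that by (auto simp: W_def)
        then show ?thesis using W_uniq[OF that(1,3) AW] that(3) by blast
      qed
      have evA: "A u = u" if "even (j u)" for u using that by (simp add: A_def)
      show False
      proof (cases "even (j x) = even (j y)")
        case True
        then have jxy: "j x = j y" using jadj by presburger
        have eq: "l0 x = l0 y"
          using diff0[OF xy kxy jxy] \<epsilon>r \<epsilon>sc[of "j x"] by force
        show False
        proof (cases "odd (j x) \<and> W x \<noteq> {}")
          case True
          then have "A x = A y" using jxy W_cong[OF kxy eq] by (simp add: A_def)
          then show False using ne by (simp add: l_def)
        next
          case False
          then have "A x = x" "A y = y" using jxy W_cong[OF kxy eq] by (auto simp: A_def)
          then show False using ne eq by (simp add: l_def)
        qed
      next
        case False
        then show False
          using mixed[of x y] mixed[of y x] evA[of x] evA[of y] xy kxy \<epsilon>r ne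
          by (cases "even (j x)") (auto simp: l_def mdist_commute)
      qed
    qed
    show "if l x = l y then mdist X x y \<le> (2 * c + 2) * \<rho> x
        else 1 / (16 * (c + 2)) * \<rho> x \<le> mdist X x y"
      using same diff by simp
  qed
  then show ?thesis by blast
qed


section \<open>A partition of unity with anchors\<close>

text \<open>The change of \<open>u i / sum u I\<close> consists of the change of the numerator and that of the denominator,
and the latter is at most the sum of the former over all \<open>i\<close>.\<close>

lemma sum_abs_diff_normalised_le:
  fixes u v :: "'i \<Rightarrow> real"
  assumes "finite I" "\<And>i. i \<in> I \<Longrightarrow> 0 \<le> v i" and u: "sum u I > 0" and v: "sum v I > 0"
  shows "(\<Sum>i\<in>I. \<bar>u i / sum u I - v i / sum v I\<bar>) \<le> 2 * (\<Sum>i\<in>I. \<bar>u i - v i\<bar>) / sum u I"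
proof -
  let ?S = "sum u I" and ?T = "sum v I"
  have "\<bar>u i / ?S - v i / ?T\<bar> \<le> \<bar>u i - v i\<bar> / ?S + v i * (\<bar>?T - ?S\<bar> / (?S * ?T))" if "i \<in> I" for i
  proof -
    have "u i / ?S - v i / ?T = (u i - v i) / ?S + v i * ((?T - ?S) / (?S * ?T))"
      using u v by (simp add: field_simps)
    also have "\<bar>\<dots>\<bar> \<le> \<bar>(u i - v i) / ?S\<bar> + \<bar>v i * ((?T - ?S) / (?S * ?T))\<bar>" by (rule abs_triangle_ineq)
    also have "\<dots> = \<bar>u i - v i\<bar> / ?S + v i * (\<bar>?T - ?S\<bar> / (?S * ?T))"
      using u v assms(2)[OF that] by (simp add: abs_mult)
    finally show ?thesis .
  qed
  then have "(\<Sum>i\<in>I. \<bar>u i / ?S - v i / ?T\<bar>)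
      \<le> (\<Sum>i\<in>I. \<bar>u i - v i\<bar> / ?S + v i * (\<bar>?T - ?S\<bar> / (?S * ?T)))" by (rule sum_mono)
  also have "\<dots> = (\<Sum>i\<in>I. \<bar>u i - v i\<bar>) / ?S + ?T * (\<bar>?T - ?S\<bar> / (?S * ?T))"
    by (simp add: sum.distrib sum_divide_distrib sum_distrib_right)
  also have "?T * (\<bar>?T - ?S\<bar> / (?S * ?T)) = \<bar>?T - ?S\<bar> / ?S"
    using v by simp
  also have "\<bar>?T - ?S\<bar> \<le> (\<Sum>i\<in>I. \<bar>u i - v i\<bar>)"
    using sum_abs[of "\<lambda>i. u i - v i" I] by (simp add: sum_subtractf abs_minus_commute)
  then have "\<bar>?T - ?S\<bar> / ?S \<le> (\<Sum>i\<in>I. \<bar>u i - v i\<bar>) / ?S"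
    using u by (simp add: divide_right_mono)
  finally show ?thesis by simp
qed

text \<open>The weight of colour \<open>k\<close> is the normalised depth of \<open>x\<close> in the \<open>(b/4) \<rho>\<close>-neighbourhood of all
points of colour \<open>k\<close>. By separation, the points of colour \<open>k\<close> within \<open>(b/4) \<rho> x\<close> of \<open>x\<close> all belong
to one piece, and the same piece is found from every point sufficiently near \<open>x\<close>. Choosing one
point \<open>zz\<close> of \<open>Z\<close> per piece therefore gives anchors \<open>z x k\<close> that are locally constant where the
weight is nonzero. The sum of the depths is at least \<open>(b/4) \<rho> x\<close> because \<open>x\<close> has full depth in its
own colour; this makes normalisation possible and gives the Lipschitz bound.\<close>

lemma whitney_weights:
  fixes X :: "'a metric" and l :: "'a \<Rightarrow> 'l"
  assumes wc: "whitney_colouring X n a b (dist_set X Z) \<kappa> l"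
    and Z: "Z \<noteq> {}" "Z \<subseteq> mspace X" and a: "0 \<le> a" and b: "0 < b" "b \<le> 1"
  defines "U \<equiv> {x \<in> mspace X. 0 < dist_set X Z x}"
  obtains g :: "'a \<Rightarrow> nat \<Rightarrow> real" and z :: "'a \<Rightarrow> nat \<Rightarrow> 'a"
  where "\<And>x k. x \<in> U \<Longrightarrow> 0 \<le> g x k" "\<And>x k. x \<in> U \<Longrightarrow> n < k \<Longrightarrow> g x k = 0"
    "\<And>x. x \<in> U \<Longrightarrow> (\<Sum>k\<le>n. g x k) = 1"
    "\<And>x k. z x k \<in> Z"
    "\<And>x k. x \<in> U \<Longrightarrow> g x k \<noteq> 0 \<Longrightarrow> mdist X x (z x k) \<le> (6 * a + 5) * dist_set X Z x"
    "\<And>x y k. x \<in> U \<Longrightarrow> y \<in> U \<Longrightarrow> mdist X x y < b / 8 * dist_set X Z x \<Longrightarrow>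
       g x k \<noteq> 0 \<Longrightarrow> g y k \<noteq> 0 \<Longrightarrow> z x k = z y k"
    "\<And>x y. x \<in> U \<Longrightarrow> y \<in> U \<Longrightarrow>
       (\<Sum>k\<le>n. \<bar>g x k - g y k\<bar>) \<le> 16 * real (Suc n) / b * mdist X x y / dist_set X Z x"
proof -
  define \<rho> where "\<rho> = dist_set X Z"
  define K where "K k = {w \<in> U. \<kappa> w = k}" for k
  define \<sigma> where "\<sigma> k x = (if K k = {} then 0 else max 0 (b / 4 * \<rho> x - dist_set X (K k) x))" for k x
  define S where "S x = (\<Sum>k\<le>n. \<sigma> k x)" for x
  define g where "g x k = (if k \<le> n then \<sigma> k x / S x else 0)" for x k
  have UX: "x \<in> mspace X" "\<rho> x > 0" if "x \<in> U" for x using that by (auto simp: U_def \<rho>_def)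
  have KX: "K k \<subseteq> mspace X" for k by (auto simp: K_def U_def)
  have tri: "mdist X x z \<le> mdist X x y + mdist X y z" if "x \<in> U" "y \<in> U" "z \<in> mspace X" for x y z
    using that by (intro mdist_triangle) (auto simp: U_def)
  have \<rho>lip: "\<bar>\<rho> x - \<rho> y\<bar> \<le> mdist X x y" if "x \<in> U" "y \<in> U" for x y
    unfolding \<rho>_def using that Z by (intro dist_set_abs_diff_le) (auto simp: U_def)
  have wcn: "\<kappa> x \<le> n" if "x \<in> U" for x
    using wc that by (auto simp: whitney_colouring_def U_def)
  have wcs: "mdist X x y \<le> a * \<rho> x" if "x \<in> U" "y \<in> U" "\<kappa> x = \<kappa> y" "l x = l y" for x y
    using wc that unfolding whitney_colouring_def U_def \<rho>_def mem_Collect_eq by metis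
  have wcd: "b * \<rho> x \<le> mdist X x y" if "x \<in> U" "y \<in> U" "\<kappa> x = \<kappa> y" "l x \<noteq> l y" for x y
    using wc that unfolding whitney_colouring_def U_def \<rho>_def mem_Collect_eq by metis
  have \<sigma>0: "0 \<le> \<sigma> k x" for k x by (simp add: \<sigma>_def)
  have \<sigma>lip: "\<bar>\<sigma> k x - \<sigma> k y\<bar> \<le> 2 * mdist X x y" if "x \<in> U" "y \<in> U" for k x y
  proof (cases "K k = {}")
    case False
    let ?d = "dist_set X (K k)"
    have d: "\<bar>?d x - ?d y\<bar> \<le> mdist X x y"
      using that UX by (intro dist_set_abs_diff_le[OF False KX]) auto
    have "b / 4 * \<bar>\<rho> x - \<rho> y\<bar> \<le> 1 * mdist X x y"
      using b \<rho>lip[OF that] by (intro mult_mono) auto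
    then have "\<bar>b / 4 * \<rho> x - b / 4 * \<rho> y\<bar> \<le> mdist X x y"
      using b by (simp only: right_diff_distrib[symmetric] abs_mult)
    then show ?thesis using d False unfolding \<sigma>_def by (simp add: max_def abs_le_iff)
  qed (simp add: \<sigma>_def)
  have near: "\<exists>w. w \<in> U \<and> \<kappa> w = k \<and> mdist X x w < b / 4 * \<rho> x" if "\<sigma> k x > 0" for k x
  proof -
    have "K k \<noteq> {}" "dist_set X (K k) x < b / 4 * \<rho> x" using that by (auto simp: \<sigma>_def max_def split: if_splits)
    then show ?thesis using dist_set_less_imp[of "K k" X x "b / 4 * \<rho> x"] by (auto simp: K_def)
  qed
  have S: "S x \<ge> b / 4 * \<rho> x" if x: "x \<in> U" for x
  proof -
    have xK: "x \<in> K (\<kappa> x)" using x by (simp add: K_def)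
    then have "dist_set X (K (\<kappa> x)) x \<le> 0" using dist_set_le[OF xK, of X x] UX[OF x] by simp
    then have "b / 4 * \<rho> x \<le> max 0 (b / 4 * \<rho> x - dist_set X (K (\<kappa> x)) x)" by linarith
    also have "\<dots> = \<sigma> (\<kappa> x) x" using xK by (auto simp: \<sigma>_def)
    also have "\<sigma> (\<kappa> x) x \<le> S x" unfolding S_def using wcn[OF x] \<sigma>0 by (intro member_le_sum) auto
    finally show ?thesis .
  qed
  have Sp: "S x > 0" if "x \<in> U" for x
    using S[OF that] UX[OF that] b by (smt (verit) divide_pos_pos mult_pos_pos)
  define zz where "zz k c = (SOME z. z \<in> Z \<and> (\<exists>w\<in>U. \<kappa> w = k \<and> l w = c \<and> mdist X w z < 2 * \<rho> w))" for k c
  have zz: "zz (\<kappa> u) (l u) \<in> Z \<and> mdist X u (zz (\<kappa> u) (l u)) \<le> (3 * a + 2) * \<rho> u" if u: "u \<in> U" for u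
  proof -
    have "dist_set X Z u < 2 * \<rho> u" using UX[OF u] by (simp add: \<rho>_def)
    then obtain z0 where "z0 \<in> Z" "mdist X u z0 < 2 * \<rho> u" using dist_set_less_imp[OF Z(1)] by metis
    then have "\<exists>z. z \<in> Z \<and> (\<exists>w\<in>U. \<kappa> w = \<kappa> u \<and> l w = l u \<and> mdist X w z < 2 * \<rho> w)" using u by blast
    from someI_ex[OF this] obtain w where w: "zz (\<kappa> u) (l u) \<in> Z" "w \<in> U" "\<kappa> w = \<kappa> u" "l w = l u"
      "mdist X w (zz (\<kappa> u) (l u)) < 2 * \<rho> w" unfolding zz_def by blast
    have d: "mdist X u w \<le> a * \<rho> u" using wcs[OF u w(2)] w(3,4) by simp
    have "mdist X u (zz (\<kappa> u) (l u)) \<le> mdist X u w + mdist X w (zz (\<kappa> u) (l u))"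
      using w(1) Z by (intro tri u w(2)) auto
    moreover have "\<rho> w \<le> \<rho> u + a * \<rho> u" using \<rho>lip[OF u w(2)] d by linarith
    ultimately show ?thesis using d w(5) w(1) by (simp add: algebra_simps)
  qed
  define w where "w x k = (SOME w. w \<in> U \<and> \<kappa> w = k \<and> mdist X x w < b / 4 * \<rho> x)" for x k
  have w: "w x k \<in> U" "\<kappa> (w x k) = k" "mdist X x (w x k) < b / 4 * \<rho> x" if "\<sigma> k x > 0" for x k
    using someI_ex[OF near[OF that]] unfolding w_def by blast+
  define z where "z x k = (if \<sigma> k x > 0 then zz k (l (w x k)) else SOME z. z \<in> Z)" for x k
  have gpos: "\<sigma> k x > 0" if "g x k \<noteq> 0" for x k
    using that \<sigma>0[of k x] by (auto simp: g_def split: if_splits)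
  have b\<rho>: "b * \<rho> x \<le> \<rho> x" if "x \<in> U" for x using b UX[OF that] by simp
  show thesis
  proof
    show "0 \<le> g x k" if "x \<in> U" for x k using \<sigma>0 Sp[OF that] by (simp add: g_def)
    show "g x k = 0" if "n < k" for x k using that by (simp add: g_def)
    show "(\<Sum>k\<le>n. g x k) = 1" if "x \<in> U" for x
      using Sp[OF that] by (simp add: g_def S_def flip: sum_divide_distrib)
    show "z x k \<in> Z" for x k
      using zz[of "w x k"] w[of k x] Z(1) by (auto simp: z_def some_in_eq)
    show "mdist X x (z x k) \<le> (6 * a + 5) * dist_set X Z x" if x: "x \<in> U" and "g x k \<noteq> 0" for x k
    proof -
      note p = gpos[OF that(2)] and wx = w[OF gpos[OF that(2)]]
      have z: "z x k \<in> Z" "mdist X (w x k) (z x k) \<le> (3 * a + 2) * \<rho> (w x k)"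
        using zz[OF wx(1)] wx(2) p by (auto simp: z_def)
      have "\<rho> (w x k) \<le> 2 * \<rho> x" using \<rho>lip[OF x wx(1)] wx(3) b\<rho>[OF x] UX[OF x] by linarith
      then have "(3 * a + 2) * \<rho> (w x k) \<le> (3 * a + 2) * (2 * \<rho> x)" using a by (intro mult_left_mono) auto
      moreover have "mdist X x (z x k) \<le> mdist X x (w x k) + mdist X (w x k) (z x k)"
        using z(1) Z by (intro tri x wx(1)) auto
      ultimately show ?thesis
        using z(2) wx(3) b\<rho>[OF x] UX[OF x] unfolding \<rho>_def[symmetric] distrib_right by linarith
    qed
    show "z x k = z y k" if xy: "x \<in> U" "y \<in> U" and d: "mdist X x y < b / 8 * dist_set X Z x"
      and "g x k \<noteq> 0" "g y k \<noteq> 0" for x y k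
    proof -
      note px = gpos[OF that(4)] and py = gpos[OF that(5)]
      note wx = w[OF px] and wy = w[OF py]
      have \<rho>y: "\<rho> y \<le> 9 / 8 * \<rho> x"
        using \<rho>lip[OF xy] d b\<rho>[OF xy(1)] unfolding \<rho>_def[symmetric] by linarith
      then have "b * \<rho> y \<le> b * (9 / 8 * \<rho> x)" using b by (intro mult_left_mono) auto
      moreover have "\<rho> (w x k) \<ge> 3 / 4 * \<rho> x" using \<rho>lip[OF xy(1) wx(1)] wx(3) b\<rho>[OF xy(1)] by linarith
      then have "b * \<rho> (w x k) \<ge> b * (3 / 4 * \<rho> x)" using b by (intro mult_left_mono) auto
      moreover have "mdist X (w x k) (w y k) \<le> mdist X x (w x k) + mdist X x y + mdist X y (w y k)"
        using tri[of "w x k" x "w y k"] tri[of x y "w y k"] xy wx(1) wy(1) UX[OF wy(1)] by (simp add: mdist_commute)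
      moreover have "b * \<rho> x > 0" using b UX[OF xy(1)] by simp
      ultimately have "mdist X (w x k) (w y k) < b * \<rho> (w x k)"
        using wx(3) wy(3) d unfolding \<rho>_def[symmetric] by linarith
      then have "l (w x k) = l (w y k)" using wcd[OF wx(1) wy(1)] wx(2) wy(2) by fastforce
      then show ?thesis using px py by (simp add: z_def)
    qed
    show "(\<Sum>k\<le>n. \<bar>g x k - g y k\<bar>) \<le> 16 * real (Suc n) / b * mdist X x y / dist_set X Z x"
      if xy: "x \<in> U" "y \<in> U" for x y
    proof -
      have "(\<Sum>k\<le>n. \<bar>g x k - g y k\<bar>) = (\<Sum>k\<le>n. \<bar>\<sigma> k x / S x - \<sigma> k y / S y\<bar>)"
        by (intro sum.cong) (auto simp: g_def)
      also have "\<dots> \<le> 2 * (\<Sum>k\<le>n. \<bar>\<sigma> k x - \<sigma> k y\<bar>) / S x"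
        using sum_abs_diff_normalised_le[of "{..n}" "\<lambda>k. \<sigma> k y" "\<lambda>k. \<sigma> k x"] \<sigma>0 Sp[OF xy(1)] Sp[OF xy(2)]
        by (simp add: S_def)
      also have "\<dots> \<le> 2 * (\<Sum>k\<le>n. 2 * mdist X x y) / S x"
        using \<sigma>lip[OF xy] Sp[OF xy(1)] by (intro divide_right_mono mult_left_mono sum_mono) auto
      also have "\<dots> \<le> 2 * (\<Sum>k\<le>n. 2 * mdist X x y) / (b / 4 * \<rho> x)"
        using S[OF xy(1)] b UX[OF xy(1)] by (intro divide_left_mono) (auto intro!: mult_pos_pos Sp xy)
      also have "\<dots> = 16 * real (Suc n) / b * mdist X x y / dist_set X Z x"
        using b by (simp add: \<rho>_def field_simps)
      finally show ?thesis .
    qed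
  qed
qed


section \<open>Lipschitz constants\<close>

lemma Lip_le:
  assumes "0 \<le> L" "\<And>x y. x \<in> mspace X \<Longrightarrow> y \<in> mspace X \<Longrightarrow> mdist Y (f x) (f y) \<le> L * mdist X x y"
  shows "Lip X Y f \<le> L"
  unfolding Lip_def
proof (rule cInf_lower)
  show "bdd_below {L. 0 \<le> L \<and> (\<forall>x\<in>mspace X. \<forall>y\<in>mspace X. mdist Y (f x) (f y) \<le> L * mdist X x y)}"
    by (rule bdd_belowI[of _ 0]) blast
qed (use assms in blast)

lemma
  assumes f: "Lipschitz_continuous_map X Y f"
  shows Lip_nonneg: "0 \<le> Lip X Y f"
    and mdist_le_Lip: "\<And>x y. x \<in> mspace X \<Longrightarrow> y \<in> mspace X \<Longrightarrow> mdist Y (f x) (f y) \<le> Lip X Y f * mdist X x y"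
proof -
  let ?S = "{L. 0 \<le> L \<and> (\<forall>x\<in>mspace X. \<forall>y\<in>mspace X. mdist Y (f x) (f y) \<le> L * mdist X x y)}"
  obtain B where "B > 0" "\<forall>x\<in>mspace X. \<forall>y\<in>mspace X. mdist Y (f x) (f y) \<le> B * mdist X x y"
    using f by (auto simp: Lipschitz_continuous_map_pos)
  then have ne: "?S \<noteq> {}" by (intro ex_in_conv[THEN iffD1] exI[of _ B]) auto
  show "0 \<le> Lip X Y f" unfolding Lip_def using ne by (intro cInf_greatest) auto
  show "mdist Y (f x) (f y) \<le> Lip X Y f * mdist X x y" if xy: "x \<in> mspace X" "y \<in> mspace X" for x y
  proof (cases "x = y")
    case True
    moreover have "f x \<in> mspace Y" using Lipschitz_continuous_map_image[OF f] xy by auto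
    ultimately show ?thesis using xy by simp
  next
    case False
    then have pos: "mdist X x y > 0" using xy by (metis mdist_nonneg mdist_zero less_le)
    have "mdist Y (f x) (f y) / mdist X x y \<le> L" if "L \<in> ?S" for L
      using that xy pos by (simp add: divide_le_eq)
    then have "mdist Y (f x) (f y) / mdist X x y \<le> Lip X Y f"
      unfolding Lip_def using ne by (intro cInf_greatest) auto
    then show ?thesis using pos by (simp add: divide_le_eq)
  qed
qed

section \<open>Barycentric weights and simplex fillings\<close>

text \<open>The simplex with vertex set \<open>A\<close> in barycentric coordinates. Weights are functions on all natural
numbers, so that a face is literally a subset and no inclusion maps are needed.\<close>

definition weights :: "nat set \<Rightarrow> (nat \<Rightarrow> real) set" where
  "weights A = {w. (\<forall>i. 0 \<le> w i) \<and> (\<forall>i. i \<notin> A \<longrightarrow> w i = 0) \<and> sum w A = 1}"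

definition weights_boundary :: "nat set \<Rightarrow> (nat \<Rightarrow> real) set" where
  "weights_boundary A = {w \<in> weights A. \<exists>i\<in>A. w i = 0}"

definition l1_dist :: "nat set \<Rightarrow> (nat \<Rightarrow> real) \<Rightarrow> (nat \<Rightarrow> real) \<Rightarrow> real" where
  "l1_dist A w w' = (\<Sum>i\<in>A. \<bar>w i - w' i\<bar>)"

definition simplex_fillable :: "'b metric \<Rightarrow> nat set \<Rightarrow> real \<Rightarrow> bool" where
  "simplex_fillable Y A C \<longleftrightarrow>
     (\<forall>L\<ge>0. \<forall>h. h \<in> weights_boundary A \<rightarrow> mspace Y \<and>
        (\<forall>w\<in>weights_boundary A. \<forall>w'\<in>weights_boundary A. mdist Y (h w) (h w') \<le> L * l1_dist A w w') \<longrightarrow>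
        (\<exists>h'. h' \<in> weights A \<rightarrow> mspace Y \<and> (\<forall>w\<in>weights_boundary A. h' w = h w) \<and>
          (\<forall>w\<in>weights A. \<forall>w'\<in>weights A. mdist Y (h' w) (h' w') \<le> C * L * l1_dist A w w')))"

lemma simplex_fillableE:
  assumes fill: "simplex_fillable Y A C" and L: "0 \<le> L" and h: "h \<in> weights_boundary A \<rightarrow> mspace Y"
    and hL: "\<And>w w'. w \<in> weights_boundary A \<Longrightarrow> w' \<in> weights_boundary A \<Longrightarrow>
      mdist Y (h w) (h w') \<le> L * l1_dist A w w'"
  obtains h' where "h' \<in> weights A \<rightarrow> mspace Y" "\<And>w. w \<in> weights_boundary A \<Longrightarrow> h' w = h w"
    "\<And>w w'. w \<in> weights A \<Longrightarrow> w' \<in> weights A \<Longrightarrow> mdist Y (h' w) (h' w') \<le> C * L * l1_dist A w w'"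
proof -
  note ex = fill[unfolded simplex_fillable_def, THEN spec, THEN mp, OF L, THEN spec, THEN mp]
  from ex[of h] h hL that show thesis by metis
qed

definition pull_weights :: "(nat \<Rightarrow> nat) \<Rightarrow> nat set \<Rightarrow> (nat \<Rightarrow> real) \<Rightarrow> nat \<Rightarrow> real" where
  "pull_weights e B w = (\<lambda>i. if i \<in> B then w (e i) else 0)"

lemma pull_weights:
  assumes e: "bij_betw e B A"
  shows "pull_weights e B \<in> weights A \<rightarrow> weights B"
    "pull_weights e B \<in> weights_boundary A \<rightarrow> weights_boundary B"
    "l1_dist B (pull_weights e B w) (pull_weights e B w') = l1_dist A w w'"
proof -
  have sum: "(\<Sum>i\<in>B. F (e i)) = sum F A" for F :: "nat \<Rightarrow> real"
    using sum.reindex_bij_betw[OF e] by simp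
  show 1: "pull_weights e B \<in> weights A \<rightarrow> weights B"
    using sum by (auto simp: weights_def pull_weights_def)
  show "pull_weights e B \<in> weights_boundary A \<rightarrow> weights_boundary B"
  proof
    fix w assume w: "w \<in> weights_boundary A"
    then obtain i where "i \<in> A" "w i = 0" by (auto simp: weights_boundary_def)
    then obtain j where "j \<in> B" "w (e j) = 0" using e by (metis bij_betw_imp_surj_on imageE)
    then show "pull_weights e B w \<in> weights_boundary B"
      using 1 w by (auto simp: weights_boundary_def pull_weights_def)
  qed
  show "l1_dist B (pull_weights e B w) (pull_weights e B w') = l1_dist A w w'"
    unfolding l1_dist_def using sum[of "\<lambda>i. \<bar>w i - w' i\<bar>"] by (simp add: pull_weights_def)
qed

lemma pull_weights_inverse:
  assumes e: "bij_betw e B A" and w: "w \<in> weights A"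
  shows "pull_weights (inv_into B e) A (pull_weights e B w) = w"
proof
  fix i
  show "pull_weights (inv_into B e) A (pull_weights e B w) i = w i"
    using w bij_betw_inv_into_right[OF e] bij_betwE[OF bij_betw_inv_into[OF e]]
    by (auto simp: pull_weights_def weights_def)
qed

lemma simplex_fillable_reindex:
  assumes B: "simplex_fillable Y B C" and e: "bij_betw e B A"
  shows "simplex_fillable Y A C"
  unfolding simplex_fillable_def
proof (intro allI impI, elim conjE)
  fix L :: real and h assume L: "0 \<le> L" and h: "h \<in> weights_boundary A \<rightarrow> mspace Y"
    and hL: "\<forall>w\<in>weights_boundary A. \<forall>w'\<in>weights_boundary A. mdist Y (h w) (h w') \<le> L * l1_dist A w w'"
  let ?T = "pull_weights e B" and ?R = "pull_weights (inv_into B e) A"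
  note R = pull_weights[OF bij_betw_inv_into[OF e]] and T = pull_weights[OF e]
  have "(h \<circ> ?R) \<in> weights_boundary B \<rightarrow> mspace Y" using h R(2) by auto
  moreover have "mdist Y ((h \<circ> ?R) w) ((h \<circ> ?R) w') \<le> L * l1_dist B w w'"
    if "w \<in> weights_boundary B" "w' \<in> weights_boundary B" for w w'
    using hL R(2,3) that by (metis PiE comp_apply)
  ultimately obtain h' where h': "h' \<in> weights B \<rightarrow> mspace Y"
    "\<And>w. w \<in> weights_boundary B \<Longrightarrow> h' w = (h \<circ> ?R) w"
    "\<And>w w'. w \<in> weights B \<Longrightarrow> w' \<in> weights B \<Longrightarrow> mdist Y (h' w) (h' w') \<le> C * L * l1_dist B w w'"
    by (rule simplex_fillableE[OF B L]) blast+
  show "\<exists>h'. h' \<in> weights A \<rightarrow> mspace Y \<and> (\<forall>w\<in>weights_boundary A. h' w = h w) \<and>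
          (\<forall>w\<in>weights A. \<forall>w'\<in>weights A. mdist Y (h' w) (h' w') \<le> C * L * l1_dist A w w')"
  proof (intro exI[of _ "h' \<circ> ?T"] conjI ballI)
    show "h' \<circ> ?T \<in> weights A \<rightarrow> mspace Y" using h'(1) T(1) by auto
    show "(h' \<circ> ?T) w = h w" if "w \<in> weights_boundary A" for w
      using h'(2)[of "?T w"] T(2) that pull_weights_inverse[OF e, of w] by (auto simp: weights_boundary_def)
    show "mdist Y ((h' \<circ> ?T) w) ((h' \<circ> ?T) w') \<le> C * L * l1_dist A w w'"
      if "w \<in> weights A" "w' \<in> weights A" for w w'
      using h'(3)[of "?T w" "?T w'"] T(1,3) that by (metis PiE comp_apply)
  qed
qed

text \<open>Lipschitz connectedness for a prescribed Lipschitz bound \<open>L\<close> in place of the optimal constant.\<close>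

lemma ball_filling:
  assumes "Lipschitz_connected m Y"
  obtains C where "0 \<le> C" "\<And>L f. 0 \<le> L \<Longrightarrow> f \<in> mspace (unit_sphere m) \<rightarrow> mspace Y \<Longrightarrow>
     (\<And>x y. x \<in> mspace (unit_sphere m) \<Longrightarrow> y \<in> mspace (unit_sphere m) \<Longrightarrow>
        mdist Y (f x) (f y) \<le> L * mdist (unit_sphere m) x y) \<Longrightarrow>
     \<exists>g. g \<in> mspace (unit_ball (m + 1)) \<rightarrow> mspace Y \<and> (\<forall>x\<in>mspace (unit_sphere m). g x = f x) \<and>
       (\<forall>x\<in>mspace (unit_ball (m + 1)). \<forall>y\<in>mspace (unit_ball (m + 1)).
          mdist Y (g x) (g y) \<le> C * L * mdist (unit_ball (m + 1)) x y)"
proof -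
  obtain c where c: "\<And>f. Lipschitz_continuous_map (unit_sphere m) Y f \<Longrightarrow>
        (\<exists>g. Lipschitz_continuous_map (unit_ball (m + 1)) Y g \<and>
             (\<forall>x\<in>mspace (unit_sphere m). g x = f x) \<and>
             Lip (unit_ball (m + 1)) Y g \<le> c * Lip (unit_sphere m) Y f)"
    using assms unfolding Lipschitz_connected_def by blast
  show thesis
  proof (rule that[of "max 0 c"])
    fix L f assume L: "0 \<le> L" and f: "f \<in> mspace (unit_sphere m) \<rightarrow> mspace Y" and
      fL: "\<And>x y. x \<in> mspace (unit_sphere m) \<Longrightarrow> y \<in> mspace (unit_sphere m) \<Longrightarrow>
        mdist Y (f x) (f y) \<le> L * mdist (unit_sphere m) x y"
    have fc: "Lipschitz_continuous_map (unit_sphere m) Y f"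
      unfolding Lipschitz_continuous_map_def using f fL by blast
    have "Lip (unit_sphere m) Y f \<le> L" using L fL by (rule Lip_le)
    then have "c * Lip (unit_sphere m) Y f \<le> max 0 c * L"
      using Lip_nonneg[OF fc] by (intro mult_mono) auto
    moreover obtain g where g: "Lipschitz_continuous_map (unit_ball (m + 1)) Y g"
      "\<forall>x\<in>mspace (unit_sphere m). g x = f x" "Lip (unit_ball (m + 1)) Y g \<le> c * Lip (unit_sphere m) Y f"
      using c[OF fc] by blast
    ultimately have "mdist Y (g x) (g y) \<le> max 0 c * L * mdist (unit_ball (m + 1)) x y"
      if "x \<in> mspace (unit_ball (m + 1))" "y \<in> mspace (unit_ball (m + 1))" for x y
      using mdist_le_Lip[OF g(1) that] by (elim order_trans) (auto intro!: mult_right_mono)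
    then show "\<exists>g. g \<in> mspace (unit_ball (m + 1)) \<rightarrow> mspace Y \<and> (\<forall>x\<in>mspace (unit_sphere m). g x = f x) \<and>
       (\<forall>x\<in>mspace (unit_ball (m + 1)). \<forall>y\<in>mspace (unit_ball (m + 1)).
          mdist Y (g x) (g y) \<le> max 0 c * L * mdist (unit_ball (m + 1)) x y)"
      using g Lipschitz_continuous_map_image[OF g(1)] by blast
  qed simp
qed

section \<open>Radial projection of a simplex onto a ball\<close>

lemma L2_set_scale: "L2_set (\<lambda>i. c * z i) A = \<bar>c\<bar> * L2_set z A" for c :: real
  by (simp add: L2_set_def power_mult_distrib real_sqrt_mult flip: sum_distrib_left)

lemma L2_set_lincomb_le:
  "L2_set (\<lambda>i. s * x i + t * y i) A \<le> \<bar>s\<bar> * L2_set x A + \<bar>t\<bar> * L2_set y A"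
  using L2_set_triangle_ineq[of "\<lambda>i. s * x i" "\<lambda>i. t * y i" A] by (simp add: L2_set_scale)

lemma L2_set_abs_diff_le: "\<bar>L2_set x A - L2_set y A\<bar> \<le> L2_set (\<lambda>i. x i - y i) A"
proof -
  have "L2_set x A \<le> L2_set (\<lambda>i. x i - y i) A + L2_set y A"
    using L2_set_triangle_ineq[of "\<lambda>i. x i - y i" y A] by simp
  moreover have "L2_set y A \<le> L2_set (\<lambda>i. y i - x i) A + L2_set x A"
    using L2_set_triangle_ineq[of "\<lambda>i. y i - x i" x A] by simp
  moreover have "L2_set (\<lambda>i. y i - x i) A = L2_set (\<lambda>i. x i - y i) A"
    by (simp add: L2_set_def power2_commute)
  ultimately show ?thesis by linarith
qed

text \<open>For a positively homogeneous \<open>p\<close> the map \<open>v \<mapsto> (p v / \<bar>v\<bar>) v\<close> carries the body \<open>p \<le> 1\<close> to the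
Euclidean unit ball along rays. The difference of two values splits into the effects of changing
\<open>p\<close>, of changing the norm and of changing the vector, each at most \<open>P \<bar>v - v'\<bar>\<close>.\<close>

lemma radial_rescaling_Lipschitz:
  fixes p :: "('i \<Rightarrow> real) \<Rightarrow> real"
  assumes A: "finite A" and p0: "\<And>v. 0 \<le> p v" "\<And>v. p v \<le> P * L2_set v A"
    and p: "\<And>v v'. \<bar>p v - p v'\<bar> \<le> P * L2_set (\<lambda>i. v i - v' i) A"
  shows "L2_set (\<lambda>i. p v / L2_set v A * v i - p v' / L2_set v' A * v' i) A
      \<le> 3 * P * L2_set (\<lambda>i. v i - v' i) A"
proof -
  let ?N = "\<lambda>v. L2_set v A" and ?d = "L2_set (\<lambda>i. v i - v' i) A"
  have Pd: "0 \<le> P * ?d" using p[of v v'] by linarith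
  consider "?N v = 0" | "?N v' = 0" | "?N v > 0" "?N v' > 0"
    using L2_set_nonneg[of v A] L2_set_nonneg[of v' A] by (auto simp: less_le)
  then show ?thesis
  proof cases
    case 1
    then have "\<And>i. i \<in> A \<Longrightarrow> v i = 0" using A by (simp add: L2_set_eq_0_iff)
    then have d: "?d = ?N v'" by (simp add: L2_set_def)
    have "L2_set (\<lambda>i. p v / ?N v * v i - p v' / ?N v' * v' i) A = L2_set (\<lambda>i. (- (p v' / ?N v')) * v' i) A"
      using 1 by simp
    also have "\<dots> = \<bar>p v' / ?N v'\<bar> * ?N v'" by (simp only: L2_set_scale abs_minus_cancel)
    also have "\<dots> \<le> p v'" using p0(1)[of v'] by auto
    also have "\<dots> \<le> P * ?d" using p0(2)[of v'] d by simp
    finally show ?thesis using Pd by simp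
  next
    case 2
    then have "\<And>i. i \<in> A \<Longrightarrow> v' i = 0" using A by (simp add: L2_set_eq_0_iff)
    then have d: "?d = ?N v" by (simp add: L2_set_def)
    have "L2_set (\<lambda>i. p v / ?N v * v i - p v' / ?N v' * v' i) A = L2_set (\<lambda>i. (p v / ?N v) * v i) A"
      using 2 by simp
    also have "\<dots> = \<bar>p v / ?N v\<bar> * ?N v" by (simp only: L2_set_scale)
    also have "\<dots> \<le> p v" using p0(1)[of v] by auto
    also have "\<dots> \<le> P * ?d" using p0(2)[of v] d by simp
    finally show ?thesis using Pd by simp
  next
    case 3
    let ?s = "(p v - p v') / ?N v + p v' * (1 / ?N v - 1 / ?N v')" and ?t = "p v' / ?N v'"
    have "(\<lambda>i. p v / ?N v * v i - p v' / ?N v' * v' i) = (\<lambda>i. ?s * v i + ?t * (v i - v' i))"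
      using 3 by (simp add: fun_eq_iff field_simps)
    then have "L2_set (\<lambda>i. p v / ?N v * v i - p v' / ?N v' * v' i) A \<le> \<bar>?s\<bar> * ?N v + \<bar>?t\<bar> * ?d"
      using L2_set_lincomb_le[of ?s v ?t "\<lambda>i. v i - v' i" A] by simp
    moreover have t: "\<bar>?t\<bar> \<le> P" using 3 p0[of v'] by (simp add: divide_le_eq)
    then have "\<bar>?t\<bar> * ?d \<le> P * ?d" by (intro mult_right_mono) auto
    moreover have "\<bar>?s\<bar> * ?N v = \<bar>(p v - p v') + ?t * (?N v' - ?N v)\<bar>"
    proof -
      have "\<bar>?s\<bar> * ?N v = \<bar>?s * ?N v\<bar>" using 3 by (simp add: abs_mult)
      also have "?s * ?N v = (p v - p v') + ?t * (?N v' - ?N v)" using 3 by (simp add: field_simps)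
      finally show ?thesis .
    qed
    moreover have "\<bar>(p v - p v') + ?t * (?N v' - ?N v)\<bar> \<le> \<bar>p v - p v'\<bar> + \<bar>?t\<bar> * \<bar>?N v' - ?N v\<bar>"
      using abs_triangle_ineq by (simp only: abs_mult[symmetric])
    moreover have "\<bar>?t\<bar> * \<bar>?N v' - ?N v\<bar> \<le> P * ?d"
      using t L2_set_abs_diff_le[of v A v'] order_trans[OF abs_ge_zero t]
      by (intro mult_mono) (simp_all add: abs_minus_commute)
    ultimately show ?thesis using p[of v v'] by linarith
  qed
qed


text \<open>Completes a vector of \<open>\<real>\<^sup>k\<close> by a coordinate of index \<open>k\<close> to a vector of coordinate sum \<open>0\<close>. Adding
\<open>1 / (k + 1)\<close> to all coordinates then yields barycentric coordinates relative to the barycentre.\<close>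

definition zero_sum :: "nat \<Rightarrow> (nat \<Rightarrow> real) \<Rightarrow> nat \<Rightarrow> real" where
  "zero_sum k v i = (if i < k then v i else if i = k then - sum v {..<k} else 0)"

text \<open>The Minkowski functional of the standard \<open>k\<close>-simplex with its barycentre moved to the origin: all
coordinates \<open>1 / (k + 1) + zero_sum k v i\<close> are nonnegative exactly if the gauge is at most \<open>1\<close>.\<close>

definition simplex_gauge :: "nat \<Rightarrow> (nat \<Rightarrow> real) \<Rightarrow> real" where
  "simplex_gauge k v = real (Suc k) * Max ((\<lambda>i. - zero_sum k v i) ` {..k})"

lemma sum_zero_sum: "(\<Sum>i\<le>k. zero_sum k v i) = 0"
proof -
  have "(\<Sum>i\<le>k. zero_sum k v i) = (\<Sum>i<k. zero_sum k v i) + zero_sum k v k"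
    by (simp add: lessThan_Suc_atMost[symmetric])
  also have "(\<Sum>i<k. zero_sum k v i) = sum v {..<k}" by (intro sum.cong) (auto simp: zero_sum_def)
  finally show ?thesis by (simp add: zero_sum_def)
qed

lemma zero_sum_scale: "zero_sum k (\<lambda>i. c * v i) = (\<lambda>i. c * zero_sum k v i)"
  by (simp add: zero_sum_def fun_eq_iff sum_distrib_left)

lemma zero_sum_diff: "zero_sum k (\<lambda>i. v i - v' i) = (\<lambda>i. zero_sum k v i - zero_sum k v' i)"
  by (simp add: zero_sum_def fun_eq_iff sum_subtractf)

lemma sum_abs_zero_sum_le: "(\<Sum>i\<le>k. \<bar>zero_sum k v i\<bar>) \<le> 2 * real k * L2_set v {..<k}"
proof -
  have "(\<Sum>i\<le>k. \<bar>zero_sum k v i\<bar>) = (\<Sum>i<k. \<bar>v i\<bar>) + \<bar>sum v {..<k}\<bar>"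
    by (simp add: lessThan_Suc_atMost[symmetric] zero_sum_def)
  also have "\<dots> \<le> 2 * (\<Sum>i<k. \<bar>v i\<bar>)" using sum_abs[of v "{..<k}"] by simp
  also have "(\<Sum>i<k. \<bar>v i\<bar>) \<le> (\<Sum>i<k. L2_set v {..<k})"
  proof (rule sum_mono)
    fix i assume "i \<in> {..<k}"
    then have "\<bar>v i\<bar> \<le> L2_set (\<lambda>i. \<bar>v i\<bar>) {..<k}" by (intro member_le_L2_set) auto
    then show "\<bar>v i\<bar> \<le> L2_set v {..<k}" by (simp add: L2_set_def)
  qed
  finally show ?thesis by simp
qed

lemma simplex_gauge_ge: "i \<le> k \<Longrightarrow> - zero_sum k v i \<le> simplex_gauge k v / real (Suc k)"
  by (simp add: simplex_gauge_def)

lemma simplex_gauge_attained: "\<exists>i\<le>k. - zero_sum k v i = simplex_gauge k v / real (Suc k)"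
proof -
  have "Max ((\<lambda>i. - zero_sum k v i) ` {..k}) \<in> (\<lambda>i. - zero_sum k v i) ` {..k}" by (intro Max_in) auto
  then obtain i where "i \<le> k" "Max ((\<lambda>i. - zero_sum k v i) ` {..k}) = - zero_sum k v i" by blast
  moreover have "simplex_gauge k v / real (Suc k) = Max ((\<lambda>i. - zero_sum k v i) ` {..k})"
    by (simp add: simplex_gauge_def)
  ultimately show ?thesis by metis
qed

lemma simplex_gauge_nonneg: "0 \<le> simplex_gauge k v"
proof (rule ccontr)
  assume "\<not> ?thesis"
  then have "simplex_gauge k v / real (Suc k) < 0" by (intro divide_neg_pos) auto
  then have "0 < zero_sum k v i" if "i \<le> k" for i
    using simplex_gauge_ge[OF that, of v] by linarith
  then have "0 < (\<Sum>i\<le>k. zero_sum k v i)" by (intro sum_pos) auto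
  then show False by (simp add: sum_zero_sum)
qed

text \<open>In a vector of sum \<open>0\<close> the positive and the negative parts have equal sums, so the most negative
coordinate controls the \<open>l1\<close> norm.\<close>

lemma sum_abs_zero_sum_le_gauge: "(\<Sum>i\<le>k. \<bar>zero_sum k v i\<bar>) \<le> 2 * simplex_gauge k v"
proof -
  let ?M = "simplex_gauge k v / real (Suc k)"
  have "0 \<le> ?M" using simplex_gauge_nonneg by simp
  then have "\<bar>zero_sum k v i\<bar> \<le> zero_sum k v i + 2 * ?M" if "i \<le> k" for i
    using simplex_gauge_ge[OF that, of v] by linarith
  then have "(\<Sum>i\<le>k. \<bar>zero_sum k v i\<bar>) \<le> (\<Sum>i\<le>k. zero_sum k v i + 2 * ?M)"
    by (intro sum_mono) auto
  also have "\<dots> = 2 * simplex_gauge k v"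
    by (simp add: sum.distrib sum_zero_sum)
  finally show ?thesis .
qed

lemma L2_set_le_gauge: "L2_set v {..<k} \<le> 2 * simplex_gauge k v"
proof -
  have "L2_set v {..<k} \<le> (\<Sum>i<k. \<bar>v i\<bar>)" by (rule L2_set_le_sum_abs)
  also have "\<dots> = (\<Sum>i<k. \<bar>zero_sum k v i\<bar>)" by (intro sum.cong) (auto simp: zero_sum_def)
  also have "\<dots> \<le> (\<Sum>i\<le>k. \<bar>zero_sum k v i\<bar>)" by (intro sum_mono2) auto
  also have "\<dots> \<le> 2 * simplex_gauge k v" by (rule sum_abs_zero_sum_le_gauge)
  finally show ?thesis .
qed

lemma simplex_gauge_scale:
  assumes "0 \<le> c"
  shows "simplex_gauge k (\<lambda>i. c * v i) = c * simplex_gauge k v"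
proof -
  have "Max ((\<lambda>i. - (c * zero_sum k v i)) ` {..k}) = c * Max ((\<lambda>i. - zero_sum k v i) ` {..k})"
    using mono_Max_commute[of "\<lambda>t. c * t" "(\<lambda>i. - zero_sum k v i) ` {..k}"] assms
    by (simp add: mono_def mult_left_mono image_image)
  then show ?thesis by (simp add: simplex_gauge_def zero_sum_scale)
qed

lemma simplex_gauge_diff_le:
  "\<bar>simplex_gauge k v - simplex_gauge k v'\<bar> \<le> real (Suc k) * (\<Sum>i\<le>k. \<bar>zero_sum k v i - zero_sum k v' i\<bar>)"
proof -
  have "simplex_gauge k v - simplex_gauge k v' \<le> real (Suc k) * (\<Sum>i\<le>k. \<bar>zero_sum k v i - zero_sum k v' i\<bar>)" for v v'
  proof -
    obtain i where i: "i \<le> k" "- zero_sum k v i = simplex_gauge k v / real (Suc k)"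
      using simplex_gauge_attained by blast
    have "\<bar>zero_sum k v i - zero_sum k v' i\<bar> \<le> (\<Sum>i\<le>k. \<bar>zero_sum k v i - zero_sum k v' i\<bar>)"
      using i(1) member_le_sum[of i "{..k}" "\<lambda>i. \<bar>zero_sum k v i - zero_sum k v' i\<bar>"] by simp
    then have "simplex_gauge k v / real (Suc k) - simplex_gauge k v' / real (Suc k)
        \<le> (\<Sum>i\<le>k. \<bar>zero_sum k v i - zero_sum k v' i\<bar>)"
      using i(2) simplex_gauge_ge[OF i(1), of v'] by linarith
    then show ?thesis by (simp add: divide_le_eq mult.commute flip: diff_divide_distrib)
  qed
  from this[of v v'] this[of v' v] show ?thesis by (simp add: abs_le_iff abs_minus_commute)
qed

lemma simplex_gauge_diff_le_L2:
  "\<bar>simplex_gauge k v - simplex_gauge k v'\<bar> \<le> 2 * real k * real (Suc k) * L2_set (\<lambda>i. v i - v' i) {..<k}"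
proof -
  have "\<bar>simplex_gauge k v - simplex_gauge k v'\<bar> \<le> real (Suc k) * (2 * real k * L2_set (\<lambda>i. v i - v' i) {..<k})"
    using sum_abs_zero_sum_le[of k "\<lambda>i. v i - v' i"] unfolding zero_sum_diff
    by (intro order_trans[OF simplex_gauge_diff_le] mult_left_mono) auto
  then show ?thesis by (simp add: algebra_simps)
qed

lemma zero_sum_shift:
  assumes w: "w \<in> weights {..k}" and i: "i \<le> k"
  shows "zero_sum k (\<lambda>i. w i - 1 / real (Suc k)) i = w i - 1 / real (Suc k)"
proof (cases "i < k")
  case False
  then have "i = k" using i by simp
  have "sum w {..<k} + w k = 1"
    using w by (simp add: weights_def flip: lessThan_Suc_atMost)
  moreover have "(\<Sum>i<k. w i - 1 / real (Suc k)) = sum w {..<k} - real k * (1 / real (Suc k))"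
    by (simp add: sum_subtractf)
  moreover have "real k * (1 / real (Suc k)) = 1 - 1 / real (Suc k)" by (simp add: field_simps)
  ultimately have "- (\<Sum>i<k. w i - 1 / real (Suc k)) = w k - 1 / real (Suc k)" by linarith
  then show ?thesis using \<open>i = k\<close> by (simp add: zero_sum_def)
qed (simp add: zero_sum_def)

text \<open>The map \<open>\<psi>\<close> projects the simplex radially onto the ball, and \<open>\<phi>\<close> projects the sphere back onto the
boundary of the simplex, so that \<open>\<phi> (\<psi> w) = w\<close> on the boundary. A map \<open>h\<close> on the boundary is
extended by filling \<open>h \<circ> \<phi>\<close> over the ball and composing the result with \<open>\<psi>\<close>.\<close>

lemma simplex_fillable_atMost:
  assumes "Lipschitz_connected m Y" and k: "k = m + 1"
  shows "\<exists>C\<ge>0. simplex_fillable Y {..k} C"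
proof -
  define \<beta> where "\<beta> = 1 / real (Suc k)"
  let ?p = "simplex_gauge k" and ?E = "zero_sum k" and ?N = "\<lambda>v. L2_set v {..<k}"
  let ?S = "mspace (unit_sphere m)" and ?B = "mspace (unit_ball (m + 1))"
  have S: "u \<in> ?S \<longleftrightarrow> (\<forall>i\<ge>k. u i = 0) \<and> ?N u = 1" for u
    by (auto simp: unit_sphere_def k)
  have B: "u \<in> ?B \<longleftrightarrow> (\<forall>i\<ge>k. u i = 0) \<and> ?N u \<le> 1" for u
    by (auto simp: unit_ball_def k)
  have dS: "mdist (unit_sphere m) u u' = ?N (\<lambda>i. u i - u' i)" for u u'
    by (simp add: unit_sphere_def k)
  have dB: "mdist (unit_ball (m + 1)) u u' = ?N (\<lambda>i. u i - u' i)" for u u'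
    by (simp add: unit_ball_def k)
  define V where "V w i = (if i < k then w i - \<beta> else 0)" for w :: "nat \<Rightarrow> real" and i
  define \<psi> where "\<psi> w i = ?p (V w) / ?N (V w) * V w i" for w i
  define \<phi> where "\<phi> u i = (if i \<le> k then \<beta> + ?E u i / ?p u else 0)" for u i
  have \<beta>: "\<beta> > 0" "real (Suc k) * \<beta> = 1" by (auto simp: \<beta>_def)
  have EV: "?E (V w) i = w i - \<beta>" if "w \<in> weights {..k}" "i \<le> k" for w i
  proof -
    have "?E (V w) i = ?E (\<lambda>i. w i - \<beta>) i" by (simp add: zero_sum_def V_def)
    then show ?thesis using zero_sum_shift[OF that] by (simp add: \<beta>_def)
  qed
  have p_le: "?p (V w) \<le> 1" if w: "w \<in> weights {..k}" for w
  proof -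
    obtain i where i: "i \<le> k" "- ?E (V w) i = ?p (V w) / real (Suc k)"
      using simplex_gauge_attained by blast
    moreover have "0 \<le> w i" using w by (simp add: weights_def)
    ultimately have "?p (V w) / real (Suc k) \<le> \<beta>" using EV[OF w i(1)] by linarith
    then have "?p (V w) / real (Suc k) \<le> 1 / real (Suc k)" by (simp only: \<beta>_def)
    then show ?thesis by (simp add: divide_le_cancel)
  qed
  have p_eq: "?p (V w) = 1" if w: "w \<in> weights_boundary {..k}" for w
  proof -
    have w': "w \<in> weights {..k}" using w by (simp add: weights_boundary_def)
    obtain i where i: "i \<le> k" "w i = 0" using w by (auto simp: weights_boundary_def)
    have "1 / real (Suc k) \<le> ?p (V w) / real (Suc k)"
      using EV[OF w' i(1)] i simplex_gauge_ge[OF i(1), of "V w"] by (simp add: \<beta>_def)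
    then have "1 \<le> ?p (V w)" by (simp add: divide_le_cancel)
    then show ?thesis using p_le[OF w'] by simp
  qed
  have N\<psi>: "?N (\<psi> w) = (if ?N (V w) = 0 then 0 else ?p (V w))" for w
  proof -
    have "?N (\<psi> w) = \<bar>?p (V w) / ?N (V w)\<bar> * ?N (V w)" unfolding \<psi>_def by (rule L2_set_scale)
    then show ?thesis using simplex_gauge_nonneg[of k "V w"] by simp
  qed
  have \<psi>B: "\<psi> w \<in> ?B" if "w \<in> weights {..k}" for w
  proof -
    have "\<forall>i\<ge>k. \<psi> w i = 0" by (simp add: \<psi>_def V_def)
    moreover have "?N (\<psi> w) \<le> 1" using p_le[OF that] by (simp add: N\<psi>)
    ultimately show ?thesis unfolding B by blast
  qed
  have \<psi>S: "\<psi> w \<in> ?S" and \<phi>\<psi>: "\<phi> (\<psi> w) = w" if w: "w \<in> weights_boundary {..k}" for w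
  proof -
    have w': "w \<in> weights {..k}" using w by (simp add: weights_boundary_def)
    have p: "?p (V w) = 1" by (rule p_eq[OF w])
    have "?p (V w) = 0" if N0: "?N (V w) = 0"
      using simplex_gauge_diff_le_L2[of k "V w" "\<lambda>_. 0"] N0
      by (simp add: simplex_gauge_scale[of 0 k "\<lambda>_. 0", simplified])
    then have N: "?N (V w) > 0" using p L2_set_nonneg[of "V w" "{..<k}"] by (auto simp: less_le)
    have "\<forall>i\<ge>k. \<psi> w i = 0" by (simp add: \<psi>_def V_def)
    then show "\<psi> w \<in> ?S" using p N by (simp add: S N\<psi>)
    have \<psi>: "\<psi> w = (\<lambda>i. 1 / ?N (V w) * V w i)" using p by (simp add: \<psi>_def fun_eq_iff)
    have "?p (\<psi> w) = 1 / ?N (V w)"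
      unfolding \<psi> using N p simplex_gauge_scale[of "1 / ?N (V w)" k "V w"] by simp
    moreover have "?E (\<psi> w) i = ?E (V w) i / ?N (V w)" for i
      unfolding \<psi> zero_sum_scale by simp
    ultimately have "\<phi> (\<psi> w) i = w i" if "i \<le> k" for i
      using that N EV[OF w' that] by (simp add: \<phi>_def)
    then show "\<phi> (\<psi> w) = w" using w' by (auto simp: fun_eq_iff \<phi>_def weights_def)
  qed
  define P where "P = 2 * real k * real (Suc k)"
  have P: "0 \<le> P" "2 * real k \<le> P" by (auto simp: P_def algebra_simps)
  have p0: "?p v \<le> P * ?N v" for v
    using simplex_gauge_diff_le_L2[of k v "\<lambda>_. 0"]
    by (simp add: simplex_gauge_scale[of 0 k "\<lambda>_. 0", simplified] P_def)
  have \<psi>_lip: "?N (\<lambda>i. \<psi> w i - \<psi> w' i) \<le> 3 * P * l1_dist {..k} w w'" for w w'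
  proof -
    have "?N (\<lambda>i. \<psi> w i - \<psi> w' i) \<le> 3 * P * ?N (\<lambda>i. V w i - V w' i)"
      unfolding \<psi>_def using p0 simplex_gauge_diff_le_L2[of k]
      by (intro radial_rescaling_Lipschitz) (auto simp: simplex_gauge_nonneg P_def)
    also have "?N (\<lambda>i. V w i - V w' i) \<le> (\<Sum>i<k. \<bar>V w i - V w' i\<bar>)" by (rule L2_set_le_sum_abs)
    also have "\<dots> = (\<Sum>i<k. \<bar>w i - w' i\<bar>)" by (intro sum.cong) (auto simp: V_def)
    also have "\<dots> \<le> l1_dist {..k} w w'" unfolding l1_dist_def by (intro sum_mono2) auto
    finally show ?thesis using P by (simp add: mult_left_mono)
  qed
  have pS: "?p u \<ge> 1 / 2" if "u \<in> ?S" for u using L2_set_le_gauge[of u k] that S by simp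
  have \<phi>W: "\<phi> u \<in> weights_boundary {..k}" if u: "u \<in> ?S" for u
  proof -
    have p: "?p u > 0" using pS[OF u] by simp
    have nn: "0 \<le> \<phi> u i" for i
    proof (cases "i \<le> k")
      case True
      have "- ?E u i \<le> \<beta> * ?p u" using simplex_gauge_ge[OF True, of u] by (simp add: \<beta>_def)
      then show ?thesis using True p by (simp add: \<phi>_def field_simps)
    qed (simp add: \<phi>_def)
    have "(\<Sum>i\<le>k. \<phi> u i) = (\<Sum>i\<le>k. \<beta> + ?E u i / ?p u)" by (intro sum.cong) (auto simp: \<phi>_def)
    also have "\<dots> = 1" using \<beta>(2) by (simp add: sum.distrib sum_zero_sum flip: sum_divide_distrib)
    finally have "sum (\<phi> u) {..k} = 1" .
    moreover obtain i where i: "i \<le> k" "- ?E u i = ?p u / real (Suc k)"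
      using simplex_gauge_attained by blast
    then have "?E u i = - (\<beta> * ?p u)" by (simp add: \<beta>_def)
    then have "\<phi> u i = 0" using i(1) p by (simp add: \<phi>_def)
    ultimately show ?thesis using nn i(1) by (auto simp: weights_boundary_def weights_def \<phi>_def)
  qed
  have \<phi>_lip: "l1_dist {..k} (\<phi> u) (\<phi> u') \<le> 12 * P * ?N (\<lambda>i. u i - u' i)"
    if u: "u \<in> ?S" "u' \<in> ?S" for u u'
  proof -
    let ?D = "\<Sum>i\<le>k. \<bar>?E u i - ?E u' i\<bar>" and ?d = "?N (\<lambda>i. u i - u' i)"
    have p: "?p u \<ge> 1 / 2" "?p u' \<ge> 1 / 2" using pS u by auto
    have "l1_dist {..k} (\<phi> u) (\<phi> u') = (\<Sum>i\<le>k. \<bar>?E u i / ?p u - ?E u' i / ?p u'\<bar>)"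
      unfolding l1_dist_def by (intro sum.cong) (auto simp: \<phi>_def)
    also have "\<dots> \<le> (\<Sum>i\<le>k. \<bar>?E u i - ?E u' i\<bar> / ?p u + \<bar>?E u' i\<bar> * (\<bar>?p u' - ?p u\<bar> / (?p u * ?p u')))"
    proof (rule sum_mono)
      fix i
      have "?E u i / ?p u - ?E u' i / ?p u' = (?E u i - ?E u' i) / ?p u + ?E u' i * ((?p u' - ?p u) / (?p u * ?p u'))"
        using p by (simp add: field_simps)
      also have "\<bar>\<dots>\<bar> \<le> \<bar>(?E u i - ?E u' i) / ?p u\<bar> + \<bar>?E u' i * ((?p u' - ?p u) / (?p u * ?p u'))\<bar>"
        by (rule abs_triangle_ineq)
      also have "\<dots> = \<bar>?E u i - ?E u' i\<bar> / ?p u + \<bar>?E u' i\<bar> * (\<bar>?p u' - ?p u\<bar> / (?p u * ?p u'))"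
        using p by (simp add: abs_mult)
      finally show "\<bar>?E u i / ?p u - ?E u' i / ?p u'\<bar>
        \<le> \<bar>?E u i - ?E u' i\<bar> / ?p u + \<bar>?E u' i\<bar> * (\<bar>?p u' - ?p u\<bar> / (?p u * ?p u'))" .
    qed
    also have "\<dots> = ?D / ?p u + (\<Sum>i\<le>k. \<bar>?E u' i\<bar>) * (\<bar>?p u' - ?p u\<bar> / (?p u * ?p u'))"
      by (simp only: sum.distrib sum_divide_distrib sum_distrib_right)
    also have "\<dots> \<le> ?D / ?p u + (2 * ?p u') * (\<bar>?p u' - ?p u\<bar> / (?p u * ?p u'))"
      using p sum_abs_zero_sum_le_gauge[of k u'] by (intro add_left_mono mult_right_mono) auto
    also have "\<dots> = (?D + 2 * \<bar>?p u' - ?p u\<bar>) / ?p u"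
      using p by (simp add: field_simps)
    also have "\<dots> \<le> (?D + 2 * \<bar>?p u' - ?p u\<bar>) / (1 / 2)"
      using p by (intro divide_left_mono) (auto intro!: add_nonneg_nonneg sum_nonneg)
    also have "\<dots> \<le> (P * ?d + 2 * (P * ?d)) / (1 / 2)"
    proof -
      have "?D \<le> 2 * real k * ?d" using sum_abs_zero_sum_le[of k "\<lambda>i. u i - u' i"] by (simp add: zero_sum_diff)
      also have "\<dots> \<le> P * ?d" using P by (intro mult_right_mono) auto
      finally have "?D \<le> P * ?d" .
      moreover have "\<bar>?p u' - ?p u\<bar> \<le> P * ?d"
        using simplex_gauge_diff_le_L2[of k u u'] by (simp add: P_def abs_minus_commute)
      ultimately show ?thesis by (intro divide_right_mono) auto
    qed
    also have "\<dots> \<le> 12 * P * ?d" using P by (simp add: mult_nonneg_nonneg)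
    finally show ?thesis .
  qed
  obtain C where C: "0 \<le> C" "\<And>L f. 0 \<le> L \<Longrightarrow> f \<in> ?S \<rightarrow> mspace Y \<Longrightarrow>
     (\<And>x y. x \<in> ?S \<Longrightarrow> y \<in> ?S \<Longrightarrow> mdist Y (f x) (f y) \<le> L * mdist (unit_sphere m) x y) \<Longrightarrow>
     \<exists>g. g \<in> ?B \<rightarrow> mspace Y \<and> (\<forall>x\<in>?S. g x = f x) \<and>
       (\<forall>x\<in>?B. \<forall>y\<in>?B. mdist Y (g x) (g y) \<le> C * L * mdist (unit_ball (m + 1)) x y)"
    by (rule ball_filling[OF assms(1)]) blast
  have "simplex_fillable Y {..k} (C * (36 * P * P))"
    unfolding simplex_fillable_def
  proof (intro allI impI, elim conjE)
    fix L :: real and h assume L: "0 \<le> L" and h: "h \<in> weights_boundary {..k} \<rightarrow> mspace Y"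
      and hL: "\<forall>w\<in>weights_boundary {..k}. \<forall>w'\<in>weights_boundary {..k}. mdist Y (h w) (h w') \<le> L * l1_dist {..k} w w'"
    have "(h \<circ> \<phi>) \<in> ?S \<rightarrow> mspace Y" using h \<phi>W by auto
    moreover have "mdist Y ((h \<circ> \<phi>) u) ((h \<circ> \<phi>) u') \<le> (L * (12 * P)) * mdist (unit_sphere m) u u'"
      if "u \<in> ?S" "u' \<in> ?S" for u u'
    proof -
      have "mdist Y (h (\<phi> u)) (h (\<phi> u')) \<le> L * l1_dist {..k} (\<phi> u) (\<phi> u')" using hL \<phi>W that by blast
      also have "\<dots> \<le> L * (12 * P * ?N (\<lambda>i. u i - u' i))" using \<phi>_lip[OF that] L by (rule mult_left_mono)
      finally show ?thesis by (simp add: dS mult.assoc)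
    qed
    ultimately obtain g where g: "g \<in> ?B \<rightarrow> mspace Y" "\<And>u. u \<in> ?S \<Longrightarrow> g u = h (\<phi> u)"
      "\<And>u u'. u \<in> ?B \<Longrightarrow> u' \<in> ?B \<Longrightarrow> mdist Y (g u) (g u') \<le> C * (L * (12 * P)) * mdist (unit_ball (m + 1)) u u'"
      using C(2)[of "L * (12 * P)" "h \<circ> \<phi>"] L P by auto
    show "\<exists>h'. h' \<in> weights {..k} \<rightarrow> mspace Y \<and> (\<forall>w\<in>weights_boundary {..k}. h' w = h w) \<and>
          (\<forall>w\<in>weights {..k}. \<forall>w'\<in>weights {..k}. mdist Y (h' w) (h' w') \<le> C * (36 * P * P) * L * l1_dist {..k} w w')"
    proof (intro exI[of _ "g \<circ> \<psi>"] conjI ballI)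
      show "g \<circ> \<psi> \<in> weights {..k} \<rightarrow> mspace Y" using g(1) \<psi>B by auto
      show "(g \<circ> \<psi>) w = h w" if "w \<in> weights_boundary {..k}" for w
        using g(2)[OF \<psi>S[OF that]] \<phi>\<psi>[OF that] by simp
      show "mdist Y ((g \<circ> \<psi>) w) ((g \<circ> \<psi>) w') \<le> C * (36 * P * P) * L * l1_dist {..k} w w'"
        if "w \<in> weights {..k}" "w' \<in> weights {..k}" for w w'
      proof -
        have "mdist Y (g (\<psi> w)) (g (\<psi> w')) \<le> C * (L * (12 * P)) * ?N (\<lambda>i. \<psi> w i - \<psi> w' i)"
          using g(3)[OF \<psi>B[OF that(1)] \<psi>B[OF that(2)]] by (simp only: dB)
        also have "\<dots> \<le> C * (L * (12 * P)) * (3 * P * l1_dist {..k} w w')"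
          using C(1) L P by (intro mult_left_mono \<psi>_lip) auto
        finally show ?thesis by (simp add: algebra_simps)
      qed
    qed
  qed
  moreover have "0 \<le> C * (36 * P * P)" using C(1) by (auto simp: P_def)
  ultimately show ?thesis by blast
qed


section \<open>Filling simplices by induction on the dimension\<close>

text \<open>\<open>F y\<close> spans a simplex on the vertices \<open>y i\<close> in \<open>Y\<close>, for every choice of vertices at once, and is
controlled on faces of dimension at most \<open>m\<close>. Its value at \<open>w\<close> depends only on the vertices of
nonzero weight, which makes the fillings of a face agree in all simplices that contain it.\<close>

definition simplicial_filling ::
    "'b metric \<Rightarrow> nat \<Rightarrow> nat \<Rightarrow> real \<Rightarrow> ((nat \<Rightarrow> 'b) \<Rightarrow> (nat \<Rightarrow> real) \<Rightarrow> 'b) \<Rightarrow> bool" where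
  "simplicial_filling Y n m C F \<longleftrightarrow>
     (\<forall>A y. A \<subseteq> {..n} \<and> card A \<le> Suc m \<and> range y \<subseteq> mspace Y \<longrightarrow>
        (\<forall>w\<in>weights A. F y w \<in> mspace Y \<and> (\<forall>i. w i = 1 \<longrightarrow> F y w = y i) \<and>
           (\<forall>y'. range y' \<subseteq> mspace Y \<and> (\<forall>i. w i \<noteq> 0 \<longrightarrow> y' i = y i) \<longrightarrow> F y' w = F y w) \<and>
           (\<forall>D. (\<forall>i\<in>A. \<forall>j\<in>A. mdist Y (y i) (y j) \<le> D) \<longrightarrow>
              (\<forall>w'\<in>weights A. mdist Y (F y w) (F y w') \<le> C * D * l1_dist A w w'))))"

lemma
  assumes F: "simplicial_filling Y n m C F" and A: "A \<subseteq> {..n}" "card A \<le> Suc m" and y: "range y \<subseteq> mspace Y"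
    and w: "w \<in> weights A"
  shows simplicial_filling_in: "F y w \<in> mspace Y"
    and simplicial_filling_vertex: "w i = 1 \<Longrightarrow> F y w = y i"
    and simplicial_filling_local: "range y' \<subseteq> mspace Y \<Longrightarrow> (\<And>i. w i \<noteq> 0 \<Longrightarrow> y' i = y i) \<Longrightarrow> F y' w = F y w"
    and simplicial_filling_Lipschitz: "(\<And>i j. i \<in> A \<Longrightarrow> j \<in> A \<Longrightarrow> mdist Y (y i) (y j) \<le> D) \<Longrightarrow>
      w' \<in> weights A \<Longrightarrow> mdist Y (F y w) (F y w') \<le> C * D * l1_dist A w w'"
proof -
  have F': "F y w \<in> mspace Y \<and> (\<forall>i. w i = 1 \<longrightarrow> F y w = y i) \<and>
           (\<forall>y'. range y' \<subseteq> mspace Y \<and> (\<forall>i. w i \<noteq> 0 \<longrightarrow> y' i = y i) \<longrightarrow> F y' w = F y w) \<and>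
           (\<forall>D. (\<forall>i\<in>A. \<forall>j\<in>A. mdist Y (y i) (y j) \<le> D) \<longrightarrow>
              (\<forall>w'\<in>weights A. mdist Y (F y w) (F y w') \<le> C * D * l1_dist A w w'))"
    using F[unfolded simplicial_filling_def, THEN spec[of _ A], THEN spec[of _ y]] A y w by blast
  show "F y w \<in> mspace Y" using F' by blast
  show "w i = 1 \<Longrightarrow> F y w = y i" using F' by blast
  show "range y' \<subseteq> mspace Y \<Longrightarrow> (\<And>i. w i \<noteq> 0 \<Longrightarrow> y' i = y i) \<Longrightarrow> F y' w = F y w" using F' by blast
  show "(\<And>i j. i \<in> A \<Longrightarrow> j \<in> A \<Longrightarrow> mdist Y (y i) (y j) \<le> D) \<Longrightarrow>
      w' \<in> weights A \<Longrightarrow> mdist Y (F y w) (F y w') \<le> C * D * l1_dist A w w'" using F' by blast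
qed

lemma weights_nonneg: "w \<in> weights A \<Longrightarrow> 0 \<le> w i"
  by (simp add: weights_def)

lemma weights_subset:
  assumes "w \<in> weights A" "finite A" "{i. w i \<noteq> 0} \<subseteq> B" "B \<subseteq> A"
  shows "w \<in> weights B"
proof -
  have "sum w A = sum w B" using assms by (intro sum.mono_neutral_right) auto
  then show ?thesis using assms by (auto simp: weights_def)
qed

lemma weights_support: "w \<in> weights A \<Longrightarrow> {i. w i \<noteq> 0} \<subseteq> A"
  by (auto simp: weights_def)

lemma weights_Diff:
  assumes "w \<in> weights A" "finite A" "w i = 0"
  shows "w \<in> weights (A - {i})"
  using assms weights_support[OF assms(1)] by (intro weights_subset[OF assms(1,2)]) auto

lemma l1_dist_nonneg: "0 \<le> l1_dist A w w'"
  by (simp add: l1_dist_def sum_nonneg)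

lemma l1_dist_mono: "finite B \<Longrightarrow> A \<subseteq> B \<Longrightarrow> l1_dist A w w' \<le> l1_dist B w w'"
  unfolding l1_dist_def by (intro sum_mono2) auto

lemma l1_dist_triangle: "l1_dist A w w'' \<le> l1_dist A w w' + l1_dist A w' w''"
  unfolding l1_dist_def sum.distrib[symmetric] by (intro sum_mono) linarith

lemma l1_dist_commute: "l1_dist A w w' = l1_dist A w' w"
  by (simp add: l1_dist_def abs_minus_commute)

lemma weights_vertex:
  assumes "w \<in> weights A" "finite A" "w i = 1" "j \<noteq> i"
  shows "w j = 0"
proof (cases "j \<in> A")
  case True
  have i: "i \<in> A" using assms by (auto simp: weights_def)
  have "1 = w i + sum w (A - {i})" using assms i by (simp add: weights_def sum.remove[of A i])
  then have "sum w (A - {i}) = 0" using assms(3) by simp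
  moreover have "\<And>k. 0 \<le> w k" using assms(1) by (rule weights_nonneg)
  ultimately show ?thesis using True assms(2,4) by (subst (asm) sum_nonneg_eq_0_iff) auto
qed (use assms in \<open>simp add: weights_def\<close>)

text \<open>A face of dimension \<open>0\<close> has a single point, at which the vertex of weight \<open>1\<close> is selected.\<close>

lemma simplicial_filling_0: "\<exists>F. simplicial_filling Y n 0 0 F"
proof (intro exI[of _ "\<lambda>y w. y (SOME i. w i = 1)"])
  have vertex: "\<exists>i. A = {i} \<and> w = (\<lambda>j. if j = i then 1 else 0)"
    if "A \<subseteq> {..n}" "card A \<le> Suc 0" "w \<in> weights A" for A w
  proof -
    have "finite A" using that(1) finite_subset by blast
    moreover have "A \<noteq> {}" using that(3) by (auto simp: weights_def)
    ultimately have "card A = 1" using that(2) card_gt_0_iff[of A] by linarith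
    then obtain i where "A = {i}" by (meson card_1_singletonE)
    then show ?thesis using that(3) by (auto simp: weights_def fun_eq_iff)
  qed
  have some: "(SOME j. (if j = i then 1 else 0) = (1::real)) = i" for i :: nat
    by (rule some_equality) (auto split: if_splits)
  show "simplicial_filling Y n 0 0 (\<lambda>y w. y (SOME i. w i = 1))"
    unfolding simplicial_filling_def
  proof (intro allI impI ballI, elim conjE)
    fix A w and y :: "nat \<Rightarrow> 'a"
    assume A: "A \<subseteq> {..n}" "card A \<le> Suc 0" and y: "range y \<subseteq> mspace Y" and w: "w \<in> weights A"
    obtain i where i: "A = {i}" "w = (\<lambda>j. if j = i then 1 else 0)" using vertex[OF A w] by blast
    have s: "(SOME j. w j = 1) = i" using some[of i] i(2) by simp
    have s': "w' = w" if "w' \<in> weights A" for w' using vertex[OF A that] i by auto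
    show "y (SOME i. w i = 1) \<in> mspace Y \<and> (\<forall>i. w i = 1 \<longrightarrow> y (SOME i. w i = 1) = y i) \<and>
           (\<forall>y'. range y' \<subseteq> mspace Y \<and> (\<forall>i. w i \<noteq> 0 \<longrightarrow> y' i = y i) \<longrightarrow> y' (SOME i. w i = 1) = y (SOME i. w i = 1)) \<and>
           (\<forall>D. (\<forall>i\<in>A. \<forall>j\<in>A. mdist Y (y i) (y j) \<le> D) \<longrightarrow>
              (\<forall>w'\<in>weights A. mdist Y (y (SOME i. w i = 1)) (y (SOME i. w' i = 1)) \<le> 0 * D * l1_dist A w w'))"
      unfolding s
    proof (intro conjI allI impI ballI)
      show "y i \<in> mspace Y" using y by auto
      show "y i = y j" if "w j = 1" for j using that i(2) by (auto split: if_splits)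
      show "y' i = y i" if "range y' \<subseteq> mspace Y \<and> (\<forall>i. w i \<noteq> 0 \<longrightarrow> y' i = y i)" for y'
        using that i(2) by auto
      show "mdist Y (y i) (y (SOME i. w' i = 1)) \<le> 0 * D * l1_dist A w w'" if "w' \<in> weights A" for w' D
        using s'[OF that] s \<open>y i \<in> mspace Y\<close> by simp
    qed
  qed
qed

text \<open>A filling that is Lipschitz on each facet is Lipschitz on the boundary. If \<open>w i = 0\<close> and
\<open>w' j = 0\<close>, move the mass \<open>w j\<close>, which is at most the distance of \<open>w\<close> and \<open>w'\<close>, to a third vertex:
the resulting \<open>v\<close> shares a facet with \<open>w\<close> and another one with \<open>w'\<close>. An interval has no third
vertex, but then \<open>w\<close> and \<open>w'\<close> are its end points, at distance \<open>2\<close> from each other.\<close>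

lemma boundary_Lipschitz:
  assumes F: "simplicial_filling Y n m C F" and C: "0 \<le> C" and A: "A \<subseteq> {..n}" "card A = Suc (Suc m)"
    and y: "range y \<subseteq> mspace Y" and D: "\<And>i j. i \<in> A \<Longrightarrow> j \<in> A \<Longrightarrow> mdist Y (y i) (y j) \<le> D"
    and w: "w \<in> weights_boundary A" "w' \<in> weights_boundary A"
  shows "mdist Y (F y w) (F y w') \<le> (5 * C + 1) * D * l1_dist A w w'"
proof -
  have fin: "finite A" using A(1) finite_subset by blast
  have ww: "w \<in> weights A" "w' \<in> weights A" using w by (auto simp: weights_boundary_def)
  obtain i where i: "i \<in> A" "w i = 0" using w(1) by (auto simp: weights_boundary_def)
  obtain j where j: "j \<in> A" "w' j = 0" using w(2) by (auto simp: weights_boundary_def)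
  have D0: "0 \<le> D" using D[OF i(1) i(1)] mdist_nonneg[of Y "y i" "y i"] by linarith
  let ?l = "l1_dist A w w'"
  have face: "A - {k} \<subseteq> {..n}" "card (A - {k}) \<le> Suc m" if "k \<in> A" for k
    using A(1) card_Diff_singleton[OF that] A(2) by auto
  have wi: "w \<in> weights (A - {i})" and wj: "w' \<in> weights (A - {j})"
    using weights_Diff[OF ww(1) fin i(2)] weights_Diff[OF ww(2) fin j(2)] by auto
  show ?thesis
  proof (cases "A - {i, j} = {}")
    case True
    have "A = {i, j}" using True i(1) j(1) by blast
    with A(2) have ij: "A = {i, j}" "i \<noteq> j" by auto
    have "w j = 1" "w' i = 1" using ww i j ij by (auto simp: weights_def)
    then have "mdist Y (F y w) (F y w') \<le> D"
      using simplicial_filling_vertex[OF F face[OF i(1)] y wi, of j]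
        simplicial_filling_vertex[OF F face[OF j(1)] y wj, of i] D[OF j(1) i(1)] by simp
    also have "\<dots> \<le> (5 * C + 1) * D * 1" using C D0 by (simp add: algebra_simps)
    also have "\<dots> \<le> (5 * C + 1) * D * ?l"
    proof (intro mult_left_mono)
      show "1 \<le> ?l" using ij \<open>w' i = 1\<close> i(2) by (simp add: l1_dist_def)
    qed (use C D0 in auto)
    finally show ?thesis .
  next
    case False
    then obtain k where k: "k \<in> A" "k \<noteq> i" "k \<noteq> j" by blast
    define v where "v = (\<lambda>a. if a = j then 0 else if a = k then w k + w j else w a)"
    have split: "sum f A = f j + f k + sum f (A - {j, k})" for f :: "nat \<Rightarrow> real"
    proof -
      have "sum f A = f j + sum f (A - {j})" using fin j(1) by (rule sum.remove)
      also have "sum f (A - {j}) = f k + sum f (A - {j} - {k})" using fin k by (intro sum.remove) auto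
      also have "A - {j} - {k} = A - {j, k}" by blast
      finally show ?thesis by simp
    qed
    have "sum v (A - {j, k}) = sum w (A - {j, k})" by (intro sum.cong) (auto simp: v_def)
    then have "sum v A = sum w A" unfolding split using k by (simp add: v_def)
    then have vA: "v \<in> weights A" using ww(1) k j(1) by (auto simp: weights_def v_def)
    have "v i = 0" "v j = 0" using i k by (auto simp: v_def)
    then have vi: "v \<in> weights (A - {i})" and vj: "v \<in> weights (A - {j})"
      using weights_Diff[OF vA fin] by auto
    have "sum (\<lambda>a. \<bar>w a - v a\<bar>) (A - {j, k}) = 0" by (intro sum.neutral) (auto simp: v_def)
    then have "l1_dist A w v = 2 * w j"
      unfolding l1_dist_def split using k weights_nonneg[OF ww(1), of j] by (simp add: v_def)
    moreover have "w j \<le> ?l"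
      unfolding l1_dist_def using member_le_sum[of j A "\<lambda>a. \<bar>w a - w' a\<bar>"] fin j weights_nonneg[OF ww(1), of j] by simp
    ultimately have wv: "l1_dist A w v \<le> 2 * ?l" by simp
    have vw: "l1_dist A v w' \<le> 3 * ?l"
      using l1_dist_triangle[of A v w' w] wv by (simp add: l1_dist_commute)
    have CD: "0 \<le> C * D" using C D0 by simp
    have "mdist Y (F y w) (F y v) \<le> C * D * l1_dist (A - {i}) w v"
      using D by (intro simplicial_filling_Lipschitz[OF F face[OF i(1)] y wi _ vi]) auto
    also have "\<dots> \<le> C * D * (2 * ?l)"
      using wv l1_dist_mono[of A "A - {i}" w v] fin CD by (intro mult_left_mono) auto
    finally have 1: "mdist Y (F y w) (F y v) \<le> C * D * (2 * ?l)" .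
    have "mdist Y (F y v) (F y w') \<le> C * D * l1_dist (A - {j}) v w'"
      using D by (intro simplicial_filling_Lipschitz[OF F face[OF j(1)] y vj _ wj]) auto
    also have "\<dots> \<le> C * D * (3 * ?l)"
      using vw l1_dist_mono[of A "A - {j}" v w'] fin CD by (intro mult_left_mono) auto
    finally have 2: "mdist Y (F y v) (F y w') \<le> C * D * (3 * ?l)" .
    have "mdist Y (F y w) (F y w') \<le> mdist Y (F y w) (F y v) + mdist Y (F y v) (F y w')"
      using simplicial_filling_in[OF F face[OF i(1)] y] simplicial_filling_in[OF F face[OF j(1)] y] wi vi wj
      by (intro mdist_triangle) auto
    moreover have "0 \<le> D * ?l" using D0 l1_dist_nonneg by simp
    ultimately show ?thesis using 1 2 by (simp add: algebra_simps)
  qed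
qed

text \<open>On each face with \<open>m + 2\<close> vertices the filling of the boundary is extended over the face by
connectedness in dimension \<open>m\<close>. The extension \<open>H A y\<close> is chosen for vertices that are constant outside
\<open>A\<close>, so that it cannot depend on vertices of weight \<open>0\<close>. It has to be Lipschitz with respect to
every bound \<open>D\<close> for the diameter of the vertices simultaneously, and is constructed for the
smallest one.\<close>

lemma simplicial_filling_step:
  assumes F: "simplicial_filling Y n m C F" and C: "0 \<le> C" and conn: "Lipschitz_connected m Y"
  shows "\<exists>C'\<ge>0. \<exists>F'. simplicial_filling Y n (Suc m) C' F'"
proof -
  obtain Cf where Cf: "0 \<le> Cf" "simplex_fillable Y {..Suc m} Cf"
    using simplex_fillable_atMost[OF conn, of "Suc m"] by auto
  define C' where "C' = max C (Cf * (5 * C + 1))"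
  define y0 where "y0 = (SOME y. y \<in> mspace Y)"
  define restr where "restr A y = (\<lambda>i. if i \<in> A then y i else y0)" for A :: "nat set" and y :: "nat \<Rightarrow> 'a"
  define good where "good A y h \<longleftrightarrow> h \<in> weights A \<rightarrow> mspace Y \<and> (\<forall>w\<in>weights_boundary A. h w = F y w) \<and>
     (\<forall>D. (\<forall>i\<in>A. \<forall>j\<in>A. mdist Y (y i) (y j) \<le> D) \<longrightarrow>
        (\<forall>w\<in>weights A. \<forall>w'\<in>weights A. mdist Y (h w) (h w') \<le> C' * D * l1_dist A w w'))" for A y h
  define H where "H A y = (SOME h. good A y h)" for A y
  define F' where "F' y w = (if card {i. w i \<noteq> 0} \<le> Suc m then F y w
      else H {i. w i \<noteq> 0} (restr {i. w i \<noteq> 0} y) w)" for y w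
  have C': "0 \<le> C'" "C \<le> C'" using C by (auto simp: C'_def)
  have H: "good A y (H A y)" if A: "A \<subseteq> {..n}" "card A = Suc (Suc m)" and y: "range y \<subseteq> mspace Y" for A y
  proof -
    have fin: "finite A" using A(1) finite_subset by blast
    have ne: "A \<noteq> {}" using A(2) by auto
    obtain e where "bij_betw e {..Suc m} A"
      using finite_same_card_bij[of "{..Suc m}" A] fin A(2) by auto
    then have fill: "simplex_fillable Y A Cf" by (rule simplex_fillable_reindex[OF Cf(2)])
    define D0 where "D0 = Max ((\<lambda>(i, j). mdist Y (y i) (y j)) ` (A \<times> A))"
    have D0: "mdist Y (y i) (y j) \<le> D0" if "i \<in> A" "j \<in> A" for i j
      unfolding D0_def using that fin by (intro Max_ge) auto
    have D0_le: "D0 \<le> D" if "\<forall>i\<in>A. \<forall>j\<in>A. mdist Y (y i) (y j) \<le> D" for D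
      unfolding D0_def using that fin ne by (subst Max_le_iff) auto
    obtain a where "a \<in> A" using ne by blast
    then have "0 \<le> D0" using D0[of a a] mdist_nonneg[of Y "y a" "y a"] by linarith
    then have L0: "0 \<le> (5 * C + 1) * D0" using C by simp
    have Fb: "F y \<in> weights_boundary A \<rightarrow> mspace Y"
    proof
      fix w assume w: "w \<in> weights_boundary A"
      then obtain i where i: "i \<in> A" "w i = 0" "w \<in> weights A" by (auto simp: weights_boundary_def)
      then have wi: "w \<in> weights (A - {i})"
        by (intro weights_Diff fin)
      have Ai: "A - {i} \<subseteq> {..n}" "card (A - {i}) \<le> Suc m"
        using A(1) card_Diff_singleton[OF i(1)] A(2) by auto
      show "F y w \<in> mspace Y" by (rule simplicial_filling_in[OF F Ai y wi])
    qed
    obtain h where h: "h \<in> weights A \<rightarrow> mspace Y" "\<And>w. w \<in> weights_boundary A \<Longrightarrow> h w = F y w"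
      "\<And>w w'. w \<in> weights A \<Longrightarrow> w' \<in> weights A \<Longrightarrow> mdist Y (h w) (h w') \<le> Cf * ((5 * C + 1) * D0) * l1_dist A w w'"
      by (rule simplex_fillableE[OF fill L0 Fb])
        (rule boundary_Lipschitz[OF F C A y D0], assumption+, blast)
    have "good A y h" unfolding good_def
    proof (intro conjI allI impI ballI)
      fix D w w' assume D: "\<forall>i\<in>A. \<forall>j\<in>A. mdist Y (y i) (y j) \<le> D" and w: "w \<in> weights A" "w' \<in> weights A"
      have "Cf * ((5 * C + 1) * D0) \<le> C' * D"
        using D0_le[OF D] \<open>0 \<le> D0\<close> Cf(1) C unfolding C'_def mult.assoc[symmetric] by (intro mult_mono) auto
      then show "mdist Y (h w) (h w') \<le> C' * D * l1_dist A w w'"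
        using h(3)[OF w] l1_dist_nonneg[of A w w'] by (meson mult_right_mono order_trans)
    qed (use h in auto)
    then show ?thesis unfolding H_def by (rule someI[where P = "good A y"])
  qed
  have restr: "range (restr A y) \<subseteq> mspace Y" if "range y \<subseteq> mspace Y" for A y
  proof -
    have "y 0 \<in> mspace Y" using that by auto
    then have "y0 \<in> mspace Y" unfolding y0_def by (rule someI)
    then show ?thesis using that by (auto simp: restr_def)
  qed
  have F'_low: "F' y w = F y w" if "A \<subseteq> {..n}" "card A \<le> Suc m" "w \<in> weights A" for A y w
  proof -
    have "finite A" using that(1) finite_subset by blast
    then have "card {i. w i \<noteq> 0} \<le> card A" using weights_support[OF that(3)] by (rule card_mono)
    then show ?thesis using that(2) by (simp add: F'_def)
  qed
  have F'_bd: "F' y w = F y w" "F (restr A y) w = F y w"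
    if A: "A \<subseteq> {..n}" "card A = Suc (Suc m)" and y: "range y \<subseteq> mspace Y" and w: "w \<in> weights_boundary A" for A y w
  proof -
    have fin: "finite A" using A(1) finite_subset by blast
    obtain i where i: "i \<in> A" "w i = 0" "w \<in> weights A" using w by (auto simp: weights_boundary_def)
    then have wi: "w \<in> weights (A - {i})"
      by (intro weights_Diff fin)
    have Ai: "A - {i} \<subseteq> {..n}" "card (A - {i}) \<le> Suc m"
      using A(1) card_Diff_singleton[OF i(1)] A(2) by auto
    show "F' y w = F y w" by (rule F'_low[OF Ai wi])
    show "F (restr A y) w = F y w"
      using weights_support[OF i(3)] by (intro simplicial_filling_local[OF F Ai y wi restr[OF y]]) (auto simp: restr_def)
  qed
  have F'_top: "F' y w = H A (restr A y) w"
    if A: "A \<subseteq> {..n}" "card A = Suc (Suc m)" and y: "range y \<subseteq> mspace Y" and w: "w \<in> weights A" for A y w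
  proof (cases "{i. w i \<noteq> 0} = A")
    case True
    then show ?thesis using A(2) by (simp add: F'_def)
  next
    case False
    then have "w \<in> weights_boundary A" using w weights_support[OF w] by (auto simp: weights_boundary_def)
    then show ?thesis using F'_bd[OF A y] H[OF A restr[OF y]] by (auto simp: good_def)
  qed
  have "simplicial_filling Y n (Suc m) C' F'"
    unfolding simplicial_filling_def
  proof (intro allI impI ballI, elim conjE)
    fix A w and y :: "nat \<Rightarrow> 'a"
    assume A: "A \<subseteq> {..n}" "card A \<le> Suc (Suc m)" and y: "range y \<subseteq> mspace Y" and w: "w \<in> weights A"
    have fin: "finite A" using A(1) finite_subset by blast
    show "F' y w \<in> mspace Y \<and> (\<forall>i. w i = 1 \<longrightarrow> F' y w = y i) \<and>
           (\<forall>y'. range y' \<subseteq> mspace Y \<and> (\<forall>i. w i \<noteq> 0 \<longrightarrow> y' i = y i) \<longrightarrow> F' y' w = F' y w) \<and>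
           (\<forall>D. (\<forall>i\<in>A. \<forall>j\<in>A. mdist Y (y i) (y j) \<le> D) \<longrightarrow>
              (\<forall>w'\<in>weights A. mdist Y (F' y w) (F' y w') \<le> C' * D * l1_dist A w w'))"
    proof (cases "card A \<le> Suc m")
      case True
      note low = F'_low[OF A(1) True]
      show ?thesis
      proof (intro conjI allI impI ballI, goal_cases)
        case 1
        then show ?case using simplicial_filling_in[OF F A(1) True y w] low[OF w] by simp
      next
        case (2 i)
        then show ?case using simplicial_filling_vertex[OF F A(1) True y w] low[OF w] by simp
      next
        case (3 y')
        then show ?case using simplicial_filling_local[OF F A(1) True y w, of y'] low[OF w] by simp
      next
        case (4 D w')
        have "A \<noteq> {}" using w by (auto simp: weights_def)
        then obtain i where i: "i \<in> A" by blast
        then have "mdist Y (y i) (y i) \<le> D" using 4 by blast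
        then have "0 \<le> D" using mdist_nonneg[of Y "y i" "y i"] by linarith
        have "mdist Y (F y w) (F y w') \<le> C * D * l1_dist A w w'"
          using 4 by (intro simplicial_filling_Lipschitz[OF F A(1) True y w]) auto
        also have "\<dots> \<le> C' * D * l1_dist A w w'"
          using C'(2) \<open>0 \<le> D\<close> l1_dist_nonneg by (intro mult_right_mono) auto
        finally show ?case using low 4 w by simp
      qed
    next
      case False
      then have A2: "card A = Suc (Suc m)" using A(2) by simp
      note top = F'_top[OF A(1) A2] and g = H[OF A(1) A2 restr[OF y, of A], unfolded good_def]
      show ?thesis
      proof (intro conjI allI impI ballI, goal_cases)
        case 1
        then show ?case using g w top[OF y w] by auto
      next
        case (2 i)
        have i: "i \<in> A" using 2 weights_support[OF w] by auto
        have "card (A - {i}) > 0" using card_Diff_singleton[OF i] A2 by simp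
        then obtain j where j: "j \<in> A" "j \<noteq> i" using card_gt_0_iff[of "A - {i}"] by blast
        then have wb: "w \<in> weights_boundary A" using weights_vertex[OF w fin 2] w by (auto simp: weights_boundary_def)
        have wj: "w \<in> weights (A - {j})"
          using weights_Diff[OF w fin weights_vertex[OF w fin 2 j(2)]] .
        have Aj: "A - {j} \<subseteq> {..n}" "card (A - {j}) \<le> Suc m"
          using A(1) card_Diff_singleton[OF j(1)] A2 by auto
        have "F y w = y i" by (rule simplicial_filling_vertex[where w = w, OF F Aj y wj 2])
        then show ?case using F'_bd(1)[OF A(1) A2 y wb] by simp
      next
        case (3 y')
        show ?case
        proof (cases "{i. w i \<noteq> 0} = A")
          case True
          then have "restr A y' = restr A y" using 3 by (auto simp: restr_def fun_eq_iff)
          then show ?thesis using 3 top[OF _ w] y by simp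
        next
          case False
          let ?B = "{i. w i \<noteq> 0}"
          have "?B \<subset> A" using False weights_support[OF w] by blast
          then have "card ?B < card A" by (rule psubset_card_mono[OF fin])
          then have B: "?B \<subseteq> {..n}" "card ?B \<le> Suc m" "w \<in> weights ?B"
            using A weights_support[OF w] weights_subset[OF w fin, of ?B] by auto
          then show ?thesis
            using simplicial_filling_local[OF F B(1,2) y B(3), of y'] 3 F'_low[OF B] by simp
        qed
      next
        case (4 D w')
        then have "\<forall>i\<in>A. \<forall>j\<in>A. mdist Y (restr A y i) (restr A y j) \<le> D" by (simp add: restr_def)
        then show ?case using g 4 w top[OF y] by simp
      qed
    qed
  qed
  then show ?thesis using C' by blast
qed

lemma simplicial_filling_exists:
  assumes "\<And>m. m < n \<Longrightarrow> Lipschitz_connected m Y"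
  shows "\<exists>C\<ge>0. \<exists>F. simplicial_filling Y n n C F"
proof -
  have "\<exists>C\<ge>0. \<exists>F. simplicial_filling Y n m C F" if "m \<le> n" for m
    using that
  proof (induction m)
    case 0
    show ?case using simplicial_filling_0 by blast
  next
    case (Suc m)
    then obtain C F where "0 \<le> C" "simplicial_filling Y n m C F" by auto
    then show ?case using simplicial_filling_step assms[of m] Suc.prems by fastforce
  qed
  then show ?thesis by blast
qed


section \<open>The extension theorem\<close>

text \<open>The value at a limit point of \<open>Z\<close> is characterised by its distances to the values on \<open>Z\<close>. This
condition is all that is used later: it holds for points of \<open>Z\<close> as well and implies Lipschitz
continuity by the triangle inequality.\<close>

lemma complete_limit_of_Lipschitz:
  assumes Y: "mcomplete_of Y" and Z: "Z \<subseteq> mspace X" "Z \<noteq> {}" and f: "f \<in> Z \<rightarrow> mspace Y" and L: "0 \<le> L"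
    and fL: "\<And>z z'. z \<in> Z \<Longrightarrow> z' \<in> Z \<Longrightarrow> mdist Y (f z) (f z') \<le> L * mdist X z z'"
    and x: "x \<in> mspace X" "dist_set X Z x = 0"
  shows "\<exists>y\<in>mspace Y. \<forall>z\<in>Z. mdist Y y (f z) \<le> L * mdist X x z"
proof -
  interpret Y: Metric_space "mspace Y" "mdist Y" by simp
  have "\<exists>z\<in>Z. mdist X x z < inverse (real (Suc k))" for k
    using dist_set_less_imp[OF Z(2), of X x "inverse (real (Suc k))"] x(2) by auto
  then obtain z where z: "\<And>k. z k \<in> Z" "\<And>k. mdist X x (z k) < inverse (real (Suc k))" by metis
  have zX: "z k \<in> mspace X" and fz: "f (z k) \<in> mspace Y" for k using z(1) Z f by auto
  have small: "\<exists>N. \<forall>k\<ge>N. L * mdist X x (z k) < e" if "e > 0" for e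
  proof -
    have "0 < e / (L + 1)" using that L by simp
    then obtain N where N: "inverse (real (Suc N)) < e / (L + 1)" using reals_Archimedean by blast
    have "L * mdist X x (z k) < e" if "k \<ge> N" for k
    proof -
      have "inverse (real (Suc k)) \<le> inverse (real (Suc N))" using that by (intro le_imp_inverse_le) auto
      then have "mdist X x (z k) < e / (L + 1)" using z(2)[of k] N by linarith
      then have "(L + 1) * mdist X x (z k) < e" using L by (simp add: pos_less_divide_eq mult.commute)
      then show ?thesis using mdist_nonneg[of X x "z k"] unfolding distrib_right by linarith
    qed
    then show ?thesis by blast
  qed
  have tri: "mdist Y (f (z k)) (f w) \<le> L * mdist X x (z k) + L * mdist X x w" if "w \<in> Z" for k w
  proof -
    have "mdist X (z k) w \<le> mdist X x (z k) + mdist X x w"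
      using mdist_triangle[of "z k" X x w] zX x that Z by (auto simp: mdist_commute)
    then have "L * mdist X (z k) w \<le> L * (mdist X x (z k) + mdist X x w)" using L by (rule mult_left_mono)
    then show ?thesis using fL[OF z(1)[of k] that] by (simp add: distrib_left)
  qed
  have "Y.MCauchy (\<lambda>k. f (z k))"
    unfolding Y.MCauchy_def
  proof (intro conjI allI impI)
    fix e :: real assume "e > 0"
    then obtain N where N: "\<forall>k\<ge>N. L * mdist X x (z k) < e / 2" using small[of "e / 2"] by auto
    have "mdist Y (f (z k)) (f (z k')) < e" if "N \<le> k" "N \<le> k'" for k k'
    proof -
      have "L * mdist X x (z k) < e / 2" "L * mdist X x (z k') < e / 2" using N that by auto
      then show ?thesis using tri[OF z(1), of k k'] by linarith
    qed
    then show "\<exists>N. \<forall>k k'. N \<le> k \<longrightarrow> N \<le> k' \<longrightarrow> mdist Y (f (z k)) (f (z k')) < e" by blast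
  qed (use fz in blast)
  then obtain y where "limitin Y.mtopology (\<lambda>k. f (z k)) y sequentially"
    using Y unfolding mcomplete_of_def Y.mcomplete_def by blast
  then have y: "y \<in> mspace Y" "\<And>e. e > 0 \<Longrightarrow> \<exists>N. \<forall>k\<ge>N. mdist Y (f (z k)) y < e"
    unfolding Y.limit_metric_sequentially by blast+
  have "mdist Y y (f w) \<le> L * mdist X x w" if w: "w \<in> Z" for w
  proof (rule field_le_epsilon)
    fix e :: real assume "e > 0"
    then obtain N N' where N: "\<forall>k\<ge>N. mdist Y (f (z k)) y < e / 2" "\<forall>k\<ge>N'. L * mdist X x (z k) < e / 2"
      using y(2)[of "e / 2"] small[of "e / 2"] by auto
    define k where "k = max N N'"
    have "mdist Y (f (z k)) y < e / 2" "L * mdist X x (z k) < e / 2" using N by (auto simp: k_def)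
    moreover have "mdist Y y (f w) \<le> mdist Y (f (z k)) y + mdist Y (f (z k)) (f w)"
      using mdist_triangle[of y Y "f (z k)" "f w"] y(1) fz f w by (auto simp: mdist_commute)
    ultimately show "mdist Y y (f w) \<le> L * mdist X x w + e" using tri[OF w, of k] by linarith
  qed
  then show ?thesis using y(1) by blast
qed

text \<open>Two points at distance less than \<open>\<eta> \<rho> x\<close> have the same anchors for the colours active at both, so
their weights lie in a common simplex with \<open>n + 1\<close> vertices of mutual distance at most
\<open>4 A L \<rho> x\<close>, and the bound \<open>B / \<rho> x\<close> for the variation of the weights gives the estimate. Points
farther apart are compared through a common point of \<open>Z\<close>, at distance about \<open>\<rho> x\<close> from \<open>x\<close>: the
values there differ from the value at \<open>x\<close> by a multiple of \<open>L \<rho> x\<close>, hence of the distance of the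
two points.\<close>

lemma Lipschitz_extension_of_colourings:
  fixes X :: "'a metric" and Y :: "'b metric"
  assumes col: "\<And>s. s > 0 \<Longrightarrow> \<exists>\<kappa> (l :: 'a \<Rightarrow> 'l). separated_colouring X n c s \<kappa> l"
    and c: "c > 0" and Y: "mcomplete_of Y"
    and conn: "\<And>m. m < n \<Longrightarrow> Lipschitz_connected m Y"
  obtains C where "0 \<le> C" "\<And>Z f L. Z \<noteq> {} \<Longrightarrow> Z \<subseteq> mspace X \<Longrightarrow> f \<in> Z \<rightarrow> mspace Y \<Longrightarrow> 0 \<le> L \<Longrightarrow>
      (\<And>z z'. z \<in> Z \<Longrightarrow> z' \<in> Z \<Longrightarrow> mdist Y (f z) (f z') \<le> L * mdist X z z') \<Longrightarrow>
      \<exists>g. g \<in> mspace X \<rightarrow> mspace Y \<and> (\<forall>z\<in>Z. g z = f z) \<and>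
        (\<forall>x\<in>mspace X. \<forall>x'\<in>mspace X. mdist Y (g x) (g x') \<le> C * L * mdist X x x')"
proof -
  obtain CF F where CF: "0 \<le> CF" and F: "simplicial_filling Y n n CF F"
    using simplicial_filling_exists[of n Y] conn by blast
  define a where "a = 2 * c + 2"
  define b where "b = 1 / (16 * (c + 2))"
  define A where "A = 6 * a + 5"
  define \<eta> where "\<eta> = b / 8"
  define B where "B = 16 * real (Suc n) / b"
  define E where "E = 4 * A * CF"
  define C where "C = 4 * A * CF * B + (2 * (E + A) + 2) / \<eta> + 1"
  have a: "0 \<le> a" and b: "0 < b" "b \<le> 1" using c by (auto simp: a_def b_def divide_le_eq)
  have A: "A \<ge> 1" using a by (simp add: A_def)
  have \<eta>: "0 < \<eta>" "\<eta> \<le> 1 / 8" using b by (auto simp: \<eta>_def)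
  have B: "0 \<le> B" using b by (simp add: B_def)
  have E: "0 \<le> E" using A CF by (simp add: E_def)
  have C: "0 \<le> C" using A CF B E \<eta> by (auto simp: C_def)
  show thesis
  proof (rule that[OF C])
    fix Z :: "'a set" and f :: "'a \<Rightarrow> 'b" and L :: real
    assume Z: "Z \<noteq> {}" "Z \<subseteq> mspace X" and f: "f \<in> Z \<rightarrow> mspace Y" and L: "0 \<le> L"
      and fL: "\<And>z z'. z \<in> Z \<Longrightarrow> z' \<in> Z \<Longrightarrow> mdist Y (f z) (f z') \<le> L * mdist X z z'"
    define \<rho> where "\<rho> = dist_set X Z"
    define U where "U = {x \<in> mspace X. 0 < \<rho> x}"
    have \<rho>lip: "\<bar>\<rho> x - \<rho> y\<bar> \<le> mdist X x y" if "x \<in> mspace X" "y \<in> mspace X" for x y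
      unfolding \<rho>_def using Z that by (rule dist_set_abs_diff_le)
    have \<rho>0: "0 \<le> \<rho> x" for x unfolding \<rho>_def using Z(1) by (rule dist_set_nonneg)
    obtain \<kappa> and l :: "'a \<Rightarrow> int \<times> 'l" where "whitney_colouring X n a b \<rho> \<kappa> l"
      using whitney_colouring_exists[of X n c \<rho>] col c \<rho>lip unfolding a_def b_def by blast
    then obtain g :: "'a \<Rightarrow> nat \<Rightarrow> real" and z :: "'a \<Rightarrow> nat \<Rightarrow> 'a" where
      g: "\<And>x k. x \<in> U \<Longrightarrow> 0 \<le> g x k" "\<And>x k. x \<in> U \<Longrightarrow> n < k \<Longrightarrow> g x k = 0"
         "\<And>x. x \<in> U \<Longrightarrow> (\<Sum>k\<le>n. g x k) = 1"
      and z: "\<And>x k. z x k \<in> Z"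
         "\<And>x k. x \<in> U \<Longrightarrow> g x k \<noteq> 0 \<Longrightarrow> mdist X x (z x k) \<le> A * \<rho> x"
         "\<And>x y k. x \<in> U \<Longrightarrow> y \<in> U \<Longrightarrow> mdist X x y < \<eta> * \<rho> x \<Longrightarrow> g x k \<noteq> 0 \<Longrightarrow> g y k \<noteq> 0 \<Longrightarrow> z x k = z y k"
      and gl: "\<And>x y. x \<in> U \<Longrightarrow> y \<in> U \<Longrightarrow> (\<Sum>k\<le>n. \<bar>g x k - g y k\<bar>) \<le> B * mdist X x y / \<rho> x"
      unfolding \<rho>_def U_def A_def \<eta>_def B_def using whitney_weights[OF _ Z a b] by blast
    have gW: "g x \<in> weights {..n}" if "x \<in> U" for x using g[OF that] by (auto simp: weights_def)
    have gl1: "l1_dist {..n} (g x) (g y) \<le> B * mdist X x y / \<rho> x" if "x \<in> U" "y \<in> U" for x y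
      using gl[OF that] by (simp add: l1_dist_def)
    have near_limit: "\<exists>y\<in>mspace Y. \<forall>z\<in>Z. mdist Y y (f z) \<le> L * mdist X x z" if "x \<in> mspace X" "\<rho> x = 0" for x
      using complete_limit_of_Lipschitz[OF Y Z(2,1) f L fL that(1)] that(2) by (simp add: \<rho>_def)
    define v where "v x k = f (z x k)" for x k
    define h where "h x = (if x \<in> U then F (v x) (g x) else if x \<in> Z then f x
        else SOME y. y \<in> mspace Y \<and> (\<forall>z\<in>Z. mdist Y y (f z) \<le> L * mdist X x z))" for x
    have vY: "range (v x) \<subseteq> mspace Y" for x using z(1) f by (auto simp: v_def)
    have fin: "{k. w k \<noteq> 0} \<subseteq> {..n}" "card {k. w k \<noteq> 0} \<le> Suc n" "w \<in> weights {k. w k \<noteq> 0}"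
      if "w \<in> weights {..n}" for w
      using weights_support[OF that] card_mono[of "{..n}" "{k. w k \<noteq> 0}"] weights_subset[OF that, of "{k. w k \<noteq> 0}"] by auto
    have ZU: "\<rho> z = 0" "z \<notin> U" if "z \<in> Z" for z
    proof -
      have "\<rho> z \<le> mdist X z z" unfolding \<rho>_def using that by (rule dist_set_le)
      then show "\<rho> z = 0" using \<rho>0[of z] that Z by auto
      then show "z \<notin> U" by (simp add: U_def)
    qed
    have hZ: "h z = f z" if "z \<in> Z" for z using ZU(2)[OF that] that by (simp add: h_def)
    have h0: "h x \<in> mspace Y" "\<And>z. z \<in> Z \<Longrightarrow> mdist Y (h x) (f z) \<le> L * mdist X x z"
      if x: "x \<in> mspace X" "x \<notin> U" for x
    proof -
      have "\<rho> x = 0" using x \<rho>0[of x] by (auto simp: U_def)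
      then have ex: "\<exists>y. y \<in> mspace Y \<and> (\<forall>z\<in>Z. mdist Y y (f z) \<le> L * mdist X x z)"
        using near_limit[OF x(1)] by blast
      have "h x \<in> mspace Y \<and> (\<forall>z\<in>Z. mdist Y (h x) (f z) \<le> L * mdist X x z)"
      proof (cases "x \<in> Z")
        case True
        then show ?thesis using hZ f fL by auto
      next
        case False
        then show ?thesis using x(2) someI_ex[OF ex] by (simp add: h_def)
      qed
      then show "h x \<in> mspace Y" "\<And>z. z \<in> Z \<Longrightarrow> mdist Y (h x) (f z) \<le> L * mdist X x z" by auto
    qed
    have hU: "h x = F (v x) (g x)" if "x \<in> U" for x using that by (simp add: h_def)
    have hY: "h x \<in> mspace Y" if "x \<in> mspace X" for x
      using h0(1)[OF that] hU simplicial_filling_in[OF F _ _ vY gW] by (cases "x \<in> U") auto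
    have fd: "mdist Y (f z1) (f z2) \<le> L * (mdist X x z1 + mdist X x z2)"
      if "z1 \<in> Z" "z2 \<in> Z" "x \<in> mspace X" for x z1 z2
    proof -
      have "mdist X z1 z2 \<le> mdist X x z1 + mdist X x z2"
        using mdist_triangle[of z1 X x z2] that Z by (auto simp: mdist_commute)
      then have "L * mdist X z1 z2 \<le> L * (mdist X x z1 + mdist X x z2)" using L by (rule mult_left_mono)
      then show ?thesis using fL[OF that(1,2)] by linarith
    qed
    have anchorU: "\<exists>z\<in>Z. mdist X x z \<le> A * \<rho> x \<and> mdist Y (h x) (f z) \<le> L * (E * \<rho> x)" if x: "x \<in> U" for x
    proof -
      let ?S = "{k. g x k \<noteq> 0}"
      have xX: "x \<in> mspace X" using x by (simp add: U_def)
      note S = fin[OF gW[OF x]]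
      obtain k where k: "g x k \<noteq> 0" using g(3)[OF x] by (metis sum.neutral zero_neq_one)
      \<comment> \<open>Compare with the vertex of an active colour \<open>k\<close>, at \<open>l1\<close> distance at most \<open>2\<close>.\<close>
      let ?e = "\<lambda>i. if i = k then 1 else 0 :: real"
      have e: "?e \<in> weights ?S" using k finite_subset[OF S(1)] by (auto simp: weights_def)
      have D: "mdist Y (v x i) (v x j) \<le> L * (2 * A * \<rho> x)" if "i \<in> ?S" "j \<in> ?S" for i j
      proof -
        have "mdist X x (z x i) + mdist X x (z x j) \<le> 2 * A * \<rho> x"
          using z(2)[OF x, of i] z(2)[OF x, of j] that by simp
        then show ?thesis
          using fd[OF z(1) z(1) xX, of x i x j] L mult_left_mono order_trans unfolding v_def by blast
      qed
      have "mdist Y (F (v x) (g x)) (F (v x) ?e) \<le> CF * (L * (2 * A * \<rho> x)) * l1_dist ?S (g x) ?e"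
        using D e by (intro simplicial_filling_Lipschitz[OF F S(1,2) vY S(3)])
      also have "\<dots> \<le> CF * (L * (2 * A * \<rho> x)) * 2"
      proof (intro mult_left_mono)
        have "l1_dist ?S (g x) ?e \<le> (\<Sum>i\<in>?S. g x i + ?e i)"
          unfolding l1_dist_def using g(1)[OF x] by (intro sum_mono) (auto simp: abs_le_iff)
        also have "\<dots> = 2" using S(3) e by (simp add: sum.distrib weights_def)
        finally show "l1_dist ?S (g x) ?e \<le> 2" .
      qed (use CF L A \<rho>0[of x] in auto)
      also have "\<dots> = L * (E * \<rho> x)" by (simp add: E_def algebra_simps)
      also have "F (v x) ?e = f (z x k)"
        using simplicial_filling_vertex[OF F S(1,2) vY e, of k] by (simp add: v_def)
      finally show ?thesis using hU[OF x] z(1,2)[of x k] x k by auto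
    qed
    have far: "mdist Y (h x) (h x') \<le> C * L * mdist X x x'"
      if x: "x \<in> mspace X" "x' \<in> mspace X" and d: "\<eta> * \<rho> x \<le> mdist X x x'" "\<eta> * \<rho> x' \<le> mdist X x x'" for x x'
    proof -
      let ?d = "mdist X x x'"
      have anchor: "mdist Y (h x) (f z') \<le> L * ((E + A) * \<rho> x + mdist X x z')" if "x \<in> mspace X" "z' \<in> Z" for x z'
      proof (cases "x \<in> U")
        case True
        then obtain z where z: "z \<in> Z" "mdist X x z \<le> A * \<rho> x" "mdist Y (h x) (f z) \<le> L * (E * \<rho> x)"
          using anchorU by blast
        have "mdist Y (h x) (f z') \<le> mdist Y (h x) (f z) + mdist Y (f z) (f z')"
          using hY[OF that(1)] f z(1) that(2) by (intro mdist_triangle) auto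
        also have "\<dots> \<le> L * (E * \<rho> x) + L * (mdist X x z + mdist X x z')"
          using z(3) fd[OF z(1) that(2,1)] by linarith
        also have "\<dots> = L * (E * \<rho> x + mdist X x z + mdist X x z')" by (simp add: algebra_simps)
        also have "\<dots> \<le> L * ((E + A) * \<rho> x + mdist X x z')"
          using z(2) L by (intro mult_left_mono) (auto simp: algebra_simps)
        finally show ?thesis .
      next
        case False
        have "L * mdist X x z' \<le> L * ((E + A) * \<rho> x + mdist X x z')"
          using L E A \<rho>0[of x] by (intro mult_left_mono) auto
        then show ?thesis using h0(2)[OF that(1) False that(2)] by linarith
      qed
      have main: "mdist Y (h x) (h x') \<le> C * L * ?d + 2 * L * e" if e: "e > 0" for e
      proof -
        have "\<rho> x < \<rho> x + e" using e by simp
        then obtain z' where z': "z' \<in> Z" "mdist X x z' < \<rho> x + e"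
          unfolding \<rho>_def by (rule dist_set_less_imp[OF Z(1)])
        have "mdist X x' z' \<le> ?d + mdist X x z'"
          using mdist_triangle[of x' X x z'] x z'(1) Z by (auto simp: mdist_commute)
        moreover have "\<rho> x \<le> ?d / \<eta>" "\<rho> x' \<le> ?d / \<eta>" using d \<eta> by (simp_all add: pos_le_divide_eq mult.commute)
        moreover have "(E + A) * \<rho> x \<le> (E + A) * (?d / \<eta>)" "(E + A) * \<rho> x' \<le> (E + A) * (?d / \<eta>)"
          using calculation(2,3) E A by (intro mult_left_mono; simp)+
        moreover have "(2 * (E + A) + 2) / \<eta> * ?d = 2 * ((E + A) * (?d / \<eta>)) + 2 * (?d / \<eta>)"
          using \<eta> by (simp add: field_simps)
        moreover have "0 \<le> 4 * A * CF * B * ?d" using A CF B by simp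
        ultimately have "((E + A) * \<rho> x + mdist X x z') + ((E + A) * \<rho> x' + mdist X x' z') \<le> C * ?d + 2 * e"
          using z'(2) unfolding C_def distrib_right[of _ _ ?d] by linarith
        then have "L * (((E + A) * \<rho> x + mdist X x z') + ((E + A) * \<rho> x' + mdist X x' z')) \<le> L * (C * ?d + 2 * e)"
          using L by (rule mult_left_mono)
        moreover have "mdist Y (h x) (h x') \<le> mdist Y (h x) (f z') + mdist Y (h x') (f z')"
          using mdist_triangle[of "h x" Y "f z'" "h x'"] hY x f z'(1) by (auto simp: mdist_commute)
        ultimately show ?thesis
          using anchor[OF x(1) z'(1)] anchor[OF x(2) z'(1)] by (simp add: algebra_simps)
      qed
      show ?thesis
      proof (rule field_le_epsilon)
        fix e :: real assume "e > 0"
        then have "2 * L * (e / (2 * L + 1)) \<le> e" "e / (2 * L + 1) > 0" using L by (simp_all add: field_simps)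
        then show "mdist Y (h x) (h x') \<le> C * L * ?d + e" using main[of "e / (2 * L + 1)"] by linarith
      qed
    qed
    have near: "mdist Y (h x) (h x') \<le> C * L * mdist X x x'"
      if x: "x \<in> mspace X" "x' \<in> mspace X" and d: "mdist X x x' < \<eta> * \<rho> x" for x x'
    proof -
      let ?d = "mdist X x x'"
      have "0 < \<eta> * \<rho> x" using d mdist_nonneg[of X x x'] by linarith
      then have \<rho>p: "0 < \<rho> x" using \<eta> by (simp add: zero_less_mult_iff)
      have "\<eta> * \<rho> x \<le> 1 / 8 * \<rho> x" using \<eta>(2) \<rho>p by (intro mult_right_mono) auto
      then have d8: "?d < \<rho> x / 8" using d by simp
      then have \<rho>': "0 < \<rho> x'" "\<rho> x' \<le> 9 / 8 * \<rho> x" using \<rho>lip[OF x] \<rho>p by linarith+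
      have U: "x \<in> U" "x' \<in> U" using x \<rho>p \<rho>' by (auto simp: U_def)
      \<comment> \<open>One set of vertices serves both points, since their anchors agree where both are active.\<close>
      define zz where "zz k = (if g x k \<noteq> 0 then z x k else z x' k)" for k
      define y where "y k = f (zz k)" for k
      define S where "S = {k. g x k \<noteq> 0} \<union> {k. g x' k \<noteq> 0}"
      have zzZ: "zz k \<in> Z" for k using z(1) by (simp add: zz_def)
      have yY: "range y \<subseteq> mspace Y" using zzZ f by (auto simp: y_def)
      have S: "S \<subseteq> {..n}" using weights_support[OF gW[OF U(1)]] weights_support[OF gW[OF U(2)]] by (auto simp: S_def)
      then have cS: "card S \<le> Suc n" using card_mono[of "{..n}" S] by simp
      have gS: "g x \<in> weights S" "g x' \<in> weights S"
        using weights_subset[OF gW[OF U(1)] _ _ S] weights_subset[OF gW[OF U(2)] _ _ S] by (auto simp: S_def)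
      have zd: "mdist X x (zz k) \<le> 2 * A * \<rho> x" if k: "k \<in> S" for k
      proof (cases "g x k \<noteq> 0")
        case True
        have "0 < A * \<rho> x" using A \<rho>p by simp
        then show ?thesis using z(2)[OF U(1) True] 
          unfolding zz_def if_P[OF True] by linarith
      next
        case False
        then have "g x' k \<noteq> 0" using k by (simp add: S_def)
        then have "mdist X x' (z x' k) \<le> A * \<rho> x'" by (rule z(2)[OF U(2)])
        moreover have "A * \<rho> x' \<le> A * (9 / 8 * \<rho> x)" using A \<rho>' by (intro mult_left_mono) auto
        moreover have "mdist X x (z x' k) \<le> ?d + mdist X x' (z x' k)"
          using x z(1) Z by (intro mdist_triangle) auto
        moreover have "1 * \<rho> x \<le> A * \<rho> x" using A \<rho>p by (intro mult_right_mono) auto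
        ultimately have "mdist X x (z x' k) \<le> 2 * A * \<rho> x" using d8 \<rho>p by linarith
        then show ?thesis using False by (simp add: zz_def)
      qed
      have D: "mdist Y (y i) (y j) \<le> L * (4 * A * \<rho> x)" if "i \<in> S" "j \<in> S" for i j
      proof -
        have "L * (mdist X x (zz i) + mdist X x (zz j)) \<le> L * (4 * A * \<rho> x)"
          using zd[OF that(1)] zd[OF that(2)] L by (intro mult_left_mono) auto
        then show ?thesis using fd[OF zzZ zzZ x(1), of i j] by (simp add: y_def)
      qed
      have "h x = F y (g x)"
        unfolding hU[OF U(1)] by (rule simplicial_filling_local[OF F S cS yY gS(1) vY]) (simp add: v_def y_def zz_def)
      moreover have "h x' = F y (g x')"
        unfolding hU[OF U(2)]
        by (rule simplicial_filling_local[OF F S cS yY gS(2) vY]) (use z(3)[OF U d] in \<open>auto simp: v_def y_def zz_def\<close>)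
      ultimately have "mdist Y (h x) (h x') \<le> CF * (L * (4 * A * \<rho> x)) * l1_dist S (g x) (g x')"
        using simplicial_filling_Lipschitz[OF F S cS yY gS(1) D gS(2)] by simp
      also have "l1_dist S (g x) (g x') \<le> B * ?d / \<rho> x"
        using l1_dist_mono[OF _ S, of "g x" "g x'"] gl1[OF U] by simp
      then have "CF * (L * (4 * A * \<rho> x)) * l1_dist S (g x) (g x') \<le> CF * (L * (4 * A * \<rho> x)) * (B * ?d / \<rho> x)"
        using CF L A \<rho>p by (intro mult_left_mono) auto
      also have "\<dots> = (4 * A * CF * B) * (L * ?d)" using \<rho>p by (simp add: field_simps)
      also have "\<dots> \<le> C * (L * ?d)"
        using L E A \<eta> unfolding C_def by (intro mult_right_mono) auto
      finally show ?thesis by (simp add: mult.assoc)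
    qed
    have "mdist Y (h x) (h x') \<le> C * L * mdist X x x'" if x: "x \<in> mspace X" "x' \<in> mspace X" for x x'
      using near[OF x] near[OF x(2,1)] far[OF x] by (force simp: mdist_commute not_less)
    then show "\<exists>g. g \<in> mspace X \<rightarrow> mspace Y \<and> (\<forall>z\<in>Z. g z = f z) \<and>
        (\<forall>x\<in>mspace X. \<forall>x'\<in>mspace X. mdist Y (g x) (g x') \<le> C * L * mdist X x x')"
      using hY hZ by (intro exI[of _ h]) auto
  qed
qed

theorem theorem1p4:
  fixes X :: "'a metric" and Y :: "'b metric" and n :: int
  assumes "nagata_dim X \<le> ereal (real_of_int n)"
    and "mspace Y \<noteq> {}"
    and "mcomplete_of Y"
    and "\<And>m :: nat. int m \<le> n - 1 \<Longrightarrow> Lipschitz_connected m Y"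
  shows "Lipschitz_extension_property X Y"
proof -
  obtain y0 where y0: "y0 \<in> mspace Y" using assms(2) by blast
  \<comment> \<open>For \<open>Z = {}\<close> the optimal constant is \<open>0\<close>, and so the extension has to be constant.\<close>
  have const: "\<exists>g. Lipschitz_continuous_map X Y g \<and> (\<forall>z\<in>{}. g z = f z) \<and> Lip X Y g \<le> C * Lip (submetric X {}) Y f"
    for f :: "'a \<Rightarrow> 'b" and C
  proof (intro exI[of _ "\<lambda>_. y0"] conjI)
    have "Lip (submetric X {}) Y f = 0"
      by (intro antisym Lip_le Lip_nonneg) (auto simp: Lipschitz_continuous_map_def)
    moreover have "Lip X Y (\<lambda>_. y0) \<le> 0" using y0 by (intro Lip_le) auto
    ultimately show "Lip X Y (\<lambda>_. y0) \<le> C * Lip (submetric X {}) Y f" by simp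
  qed (use y0 in \<open>auto simp: Lipschitz_continuous_map_const\<close>)
  show ?thesis
  proof (cases "mspace X = {}")
    case True
    show ?thesis
      unfolding Lipschitz_extension_property_def
    proof (intro exI[of _ 0] allI impI, elim conjE)
      fix Z :: "'a set" and f :: "'a \<Rightarrow> 'b" assume "Z \<subseteq> mspace X"
      then have "Z = {}" using True by simp
      then show "\<exists>g. Lipschitz_continuous_map X Y g \<and> (\<forall>z\<in>Z. g z = f z) \<and>
          Lip X Y g \<le> 0 * Lip (submetric X Z) Y f" using const[of f 0] by simp
    qed
  next
    case False
    obtain c where n: "0 \<le> n" and c: "c > 0"
      and col: "\<And>s. s > 0 \<Longrightarrow> \<exists>\<kappa> (l :: 'a \<Rightarrow> 'a set set). separated_colouring X (nat n) c s \<kappa> l"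
      by (rule nagata_colourings[OF assms(1) False]) blast
    have conn: "Lipschitz_connected m Y" if "m < nat n" for m
      using that by (intro assms(4)) linarith
    obtain C where C: "0 \<le> C" and ext: "\<And>Z f L. Z \<noteq> {} \<Longrightarrow> Z \<subseteq> mspace X \<Longrightarrow> f \<in> Z \<rightarrow> mspace Y \<Longrightarrow> 0 \<le> L \<Longrightarrow>
      (\<And>z z'. z \<in> Z \<Longrightarrow> z' \<in> Z \<Longrightarrow> mdist Y (f z) (f z') \<le> L * mdist X z z') \<Longrightarrow>
      \<exists>g. g \<in> mspace X \<rightarrow> mspace Y \<and> (\<forall>z\<in>Z. g z = f z) \<and>
        (\<forall>x\<in>mspace X. \<forall>x'\<in>mspace X. mdist Y (g x) (g x') \<le> C * L * mdist X x x')"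
      by (rule Lipschitz_extension_of_colourings[OF col c assms(3) conn]) blast+
    show ?thesis
      unfolding Lipschitz_extension_property_def
    proof (intro exI[of _ C] allI impI, elim conjE)
      fix Z f assume Z: "Z \<subseteq> mspace X" and f: "Lipschitz_continuous_map (submetric X Z) Y f"
      let ?L = "Lip (submetric X Z) Y f"
      show "\<exists>g. Lipschitz_continuous_map X Y g \<and> (\<forall>z\<in>Z. g z = f z) \<and> Lip X Y g \<le> C * ?L"
      proof (cases "Z = {}")
        case True
        then show ?thesis using const by simp
      next
        case False
        have ZX: "mspace (submetric X Z) = Z" using Z by auto
        have fY: "f \<in> Z \<rightarrow> mspace Y" using Lipschitz_continuous_map_image[OF f] ZX by simp
        have fL: "mdist Y (f z) (f z') \<le> ?L * mdist X z z'" if "z \<in> Z" "z' \<in> Z" for z z'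
          using mdist_le_Lip[OF f, unfolded ZX] that by simp
        obtain g where g: "g \<in> mspace X \<rightarrow> mspace Y" "\<forall>z\<in>Z. g z = f z"
          "\<forall>x\<in>mspace X. \<forall>x'\<in>mspace X. mdist Y (g x) (g x') \<le> C * ?L * mdist X x x'"
          using ext[OF False Z fY Lip_nonneg[OF f] fL] by blast
        have "Lipschitz_continuous_map X Y g"
          unfolding Lipschitz_continuous_map_def using g(1,3) by blast
        moreover have "Lip X Y g \<le> C * ?L" using C Lip_nonneg[OF f] g(3) by (intro Lip_le) auto
        ultimately show ?thesis using g(2) by blast
      qed
    qed
  qed
qed

end
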